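(* Let $w\in F_n$ be a non-empty cyclically reduced word that is not a proper power, and suppose that $P_n(w)$ is orientable. Let $u$ (with corresponding $h$) be the shortest subword of $w$ such that $w=\prod_{i=0}^{n/(n,h)-1}\theta^{ih}(u)$ for any $0\leq h<n$. Let $\Gamma$ be the star graph of $P_n(w)$ and let $\mathcal{A},\mathcal{B},\mathcal{Q}$ be the multisets, associated with $u,h$, defined in the context. Let $d_\mathcal{A}=\gcd(n,a\ (a\in\mathcal{A}))$, $d_\mathcal{B}=\gcd(n,b\ (b\in\mathcal{B}))$, and if $u$ is not cyclically alternating let $q_0\in\mathcal{Q}$ and set $d=\gcd(n,\ a\ (a\in\mathcal{A}),\ b\ (b\in\mathcal{B}),\ q-q_0\ (q\in\mathcal{Q}))$. Then $\Gamma$ is $l(u)$-regular, has vertices $x_i,x_i^{-1}$ ($0\leq i<n$), and has edges $x_i-x_{i+a}$, $x_i^{-1}-x_{i+b}^{-1}$, $x_i-x_{i+q}^{-1}$ for all $a\in\mathcal{A}$, $b\in\mathcal{B}$, $q\in\mathcal{Q}$, $0\leq i<n$. Moreover: (a) If $u$ is not cyclically alternating then $\Gamma$ has $d$ connected components $\Gamma_0,\ldots,\Gamma_{d-1}$, where for $0\leq j<d$ the graph $\Gamma_j$ is the induced subgraph of $\Gamma$ with vertex set $V(\Gamma_j)=V(\Gamma_j^+)\cup V(\Gamma_j^-)$, where $\Gamma_j^+$ and $\Gamma_j^-$ are the induced subgraphs of $\Gamma$ with vertex sets \[V(\Gamma_j^+)=\{x_{j+td}\mid 0\leq t<n/d\},\qquad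 V(\Gamma_j^-)=\{x_{j+td+q_0}^{-1}\mid 0\leq t<n/d\}\] (subscripts mod $n$). In particular, $|V(\Gamma_j^+)|=|V(\Gamma_j^-)|=n/d$ for all $0\leq j<d$, and the subscripts of the positive (resp. negative) vertices in any component are congruent mod $d$. (b) If $u$ is cyclically alternating then $\Gamma$ has $d_\mathcal{A}+d_\mathcal{B}$ connected components $\Gamma_0^+,\ldots,\Gamma_{d_\mathcal{A}-1}^+,\Gamma_0^-,\ldots,\Gamma_{d_\mathcal{B}-1}^-$, which are, respectively, the induced labelled subgraphs of $\Gamma$ with vertex sets \[V(\Gamma_j^+)=\{x_{j+td_\mathcal{A}}\mid 0\leq t<n/d_\mathcal{A}\},\qquad V(\Gamma_j^-)=\{x_{j+td_\mathcal{B}}^{-1}\mid 0\leq t<n/d_\mathcal{B}\}\] (subscripts mod $n$). Moreover, each component $\Gamma_j^+$ is isomorphic to the circulant graph $\mathrm{circ}_{n/d_\mathcal{A}}(\{a/d_\mathcal{A}\ (a\in\mathcal{A})\})$ and each component $\Gamma_j^-$ is isomorphic to the circulant graph $\mathrm{circ}_{n/d_\mathcal{B}}(\{b/d_\mathcal{B}\ (b\in\mathcal{B})\})$.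
   Context: $F_n$ is the free group with basis $x_0,\ldots,x_{n-1}$; subscripts are taken modulo $n$; $\theta(x_i)=x_{i+1}$; $l(u)$ is the length of $u$; $(a,b)$ is the greatest common divisor, with $(n,0)=n$. $P_n(w)=\langle x_0,\ldots,x_{n-1}\mid w,\theta(w),\ldots,\theta^{n-1}(w)\rangle$; it is orientable if $w$ is not a cyclic permutation of the inverse of any of its shifts $\theta^i(w)$, $0\leq i<n$. "The shortest subword $u$ of $w$ such that $w=\prod\theta^{ih}(u)$ for any $0\leq h<n$" means: among all pairs $(u,h)$ with $0\leq h<n$ and $w=u\,\theta^h(u)\,\theta^{2h}(u)\cdots\theta^{(n/(n,h)-1)h}(u)$, take one with $l(u)$ minimal ($(w,0)$ is always such a pair). A word of length at least 2 is alternating if it has no subword of the form $(x_ix_j)^{\pm1}$, and cyclically alternating if it has no cyclic subword of that form (equivalently, it is alternating of even length). Let $\iota(u)$ be the initial letter of $u$. The multisets (of residues mod $n$, counted with multiplicity) are: $\mathcal{A}=\{a\mid$ there is a subword $x_ix_{i+a}^{-1}$ of $u\theta^h(\iota(u))\}$; $\mathcal{B}=\{b\mid$ there is a subword $x_i^{-1}x_{i+b}$ of $u\theta^h(\iota(u))\}$; $\mathcal{Q}=\{q\mid$ there is a subword $x_ix_{i+q}$ or $x_{i+q}^{-1}x_i^{-1}$ of $u\theta^h(\iota(u))\}$. ($\mathcal{Q}=\emptyset$ iff $u$ is cyclically alternating.) Star graph: for a presentation $\langle X\mid R\rangle$ with cyclically reduced relators, let $\tilde R$ be the set of all cyclic permutations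 of elements of $R\cup R^{-1}$. The star graph is the undirected vertex-labelled graph (multiple edges allowed) with vertex set $X\cup X^{-1}$ and an edge joining $x$ and $y$ ($x,y\in X\cup X^{-1}$) for each distinct word in $\tilde R$ of the form $xy^{-1}z$, where the edges arising from the inverse pair $xy^{-1}z$ and $yx^{-1}z^{-1}$ are identified. (Relators are read cyclically: a relator of length one, $x$, contributes one edge $x-x^{-1}$.) Vertices in $X$ are positive, those in $X^{-1}$ negative. The list of edges in the claim is a complete list with multiplicity: one edge for each choice of $i$ and each element, counted with multiplicity, of the multisets. "$r$-regular" means every vertex has degree $r$, edges being counted with multiplicity. For a multiset $A$ of residues mod $N$, $\mathrm{circ}_N(A)$ is the (multi)graph with vertices $v_0,\ldots,v_{N-1}$ and one edge $v_i-v_{i+a}$ for each $0\leq i<N$ and each $a\in A$ (with multiplicity; subscripts mod $N$). *)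

theory Defs
  imports Complex_Main "HOL-Library.Multiset" "HOL-Library.Sublist" "HOL-Library.Uprod"
begin

text \<open>\<open>Pos a\<close> is the letter $a$ and \<open>Neg a\<close> is the letter $a^{-1}$. Elements of a free group
  are represented by freely reduced words; \<open>free_reduce\<close> computes the element represented by an
  arbitrary word, so that the product of $u$ and $v$ in the free group is \<open>free_reduce (u @ v)\<close>.\<close>

datatype 'a letter = Pos 'a | Neg 'a

type_synonym 'a word = "'a letter list"

fun inv_letter :: "'a letter \<Rightarrow> 'a letter" where
  "inv_letter (Pos a) = Neg a"
| "inv_letter (Neg a) = Pos a"

definition inv_word :: "'a word \<Rightarrow> 'a word" where
  "inv_word w = rev (map inv_letter w)"

definition letters :: "'a set \<Rightarrow> 'a letter set" where
  "letters X = Pos ` X \<union> Neg ` X"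

definition reduced :: "'a word \<Rightarrow> bool" where
  "reduced w \<longleftrightarrow> successively (\<lambda>x y. y \<noteq> inv_letter x) w"

definition cyclically_reduced :: "'a word \<Rightarrow> bool" where
  "cyclically_reduced w \<longleftrightarrow> reduced w \<and> (w \<noteq> [] \<longrightarrow> hd w \<noteq> inv_letter (last w))"

fun cancel_cons :: "'a letter \<Rightarrow> 'a word \<Rightarrow> 'a word" where
  "cancel_cons x [] = [x]"
| "cancel_cons x (y # ys) = (if y = inv_letter x then ys else x # y # ys)"

definition free_reduce :: "'a word \<Rightarrow> 'a word" where
  "free_reduce w = foldr cancel_cons w []"

definition free_group :: "'a set \<Rightarrow> 'a word set" where
  "free_group X = {w. reduced w \<and> set w \<subseteq> letters X}"

definition proper_power :: "'a set \<Rightarrow> 'a word \<Rightarrow> bool" where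
  "proper_power X w \<longleftrightarrow>
     (\<exists>v\<in>free_group X. \<exists>k\<ge>2. w = free_reduce (concat (replicate k v)))"

text \<open>The generator $x_i$ of $F_n$ is \<open>Pos i\<close> with \<open>i < n\<close>.\<close>

fun theta_letter :: "nat \<Rightarrow> nat letter \<Rightarrow> nat letter" where
  "theta_letter n (Pos i) = Pos ((i + 1) mod n)"
| "theta_letter n (Neg i) = Neg ((i + 1) mod n)"

definition theta :: "nat \<Rightarrow> nat word \<Rightarrow> nat word" where
  "theta n w = map (theta_letter n) w"

text \<open>A presentation is the pair of its set of generators and its set of relators.\<close>

type_synonym 'a presentation = "'a set \<times> 'a word set"

definition cyclic_presentation :: "nat \<Rightarrow> nat word \<Rightarrow> nat presentation" where
  "cyclic_presentation n w = ({..<n}, {(theta n ^^ i) w |i. i < n})"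

definition orientable :: "nat \<Rightarrow> nat word \<Rightarrow> bool" where
  "orientable n w \<longleftrightarrow> \<not> (\<exists>i<n. \<exists>k. w = rotate k (inv_word ((theta n ^^ i) w)))"

text \<open>The product $\prod_{i=0}^{n/(n,h)-1}\theta^{ih}(u)$, evaluated in $F_n$.\<close>

definition shift_product :: "nat \<Rightarrow> nat word \<Rightarrow> nat \<Rightarrow> nat word" where
  "shift_product n u h =
     free_reduce (concat (map (\<lambda>i. (theta n ^^ (i * h)) u) [0..<n div gcd n h]))"

definition shift_root :: "nat \<Rightarrow> nat word \<Rightarrow> nat word \<Rightarrow> nat \<Rightarrow> bool" where
  "shift_root n w u h \<longleftrightarrow> h < n \<and> sublist u w \<and> w = shift_product n u h"

definition shortest_shift_root :: "nat \<Rightarrow> nat word \<Rightarrow> nat word \<Rightarrow> nat \<Rightarrow> bool" where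
  "shortest_shift_root n w u h \<longleftrightarrow>
     shift_root n w u h \<and> (\<forall>u' h'. shift_root n w u' h' \<longrightarrow> length u \<le> length u')"

definition cyclically_alternating :: "'a word \<Rightarrow> bool" where
  "cyclically_alternating w \<longleftrightarrow>
     2 \<le> length w \<and>
     (\<forall>(x, y) \<in> set (zip w (rotate1 w)).
        \<not> (\<exists>i j. (x, y) = (Pos i, Pos j) \<or> (x, y) = (Neg j, Neg i)))"

text \<open>The residue of $j - i$ modulo $n$, as an element of \<open>{0..<n}\<close>.\<close>

definition residue_diff :: "nat \<Rightarrow> nat \<Rightarrow> nat \<Rightarrow> nat" where
  "residue_diff n j i = nat ((int j - int i) mod int n)"

text \<open>The list of all subwords of length two of $u\,\theta^h(\iota(u))$, one for each occurrence.\<close>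

definition two_subwords :: "nat \<Rightarrow> nat word \<Rightarrow> nat \<Rightarrow> (nat letter \<times> nat letter) list" where
  "two_subwords n u h = (let s = u @ (theta n ^^ h) [hd u] in zip s (tl s))"

definition multiset_A :: "nat \<Rightarrow> nat word \<Rightarrow> nat \<Rightarrow> nat multiset" where
  "multiset_A n u h = mset [residue_diff n j i. (Pos i, Neg j) \<leftarrow> two_subwords n u h]"

definition multiset_B :: "nat \<Rightarrow> nat word \<Rightarrow> nat \<Rightarrow> nat multiset" where
  "multiset_B n u h = mset [residue_diff n j i. (Neg i, Pos j) \<leftarrow> two_subwords n u h]"

definition multiset_Q :: "nat \<Rightarrow> nat word \<Rightarrow> nat \<Rightarrow> nat multiset" where
  "multiset_Q n u h =
     mset [residue_diff n j i. (Pos i, Pos j) \<leftarrow> two_subwords n u h] +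
     mset [residue_diff n j i. (Neg j, Neg i) \<leftarrow> two_subwords n u h]"

record 'v multigraph =
  verts :: "'v set"
  edges :: "'v uprod multiset"

text \<open>A loop contributes two to the degree of its vertex.\<close>

definition degree :: "'v multigraph \<Rightarrow> 'v \<Rightarrow> nat" where
  "degree G v =
     size {#e \<in># edges G. v \<in> set_uprod e#} + size {#e \<in># edges G. e = Upair v v#}"

definition regular :: "nat \<Rightarrow> 'v multigraph \<Rightarrow> bool" where
  "regular r G \<longleftrightarrow> (\<forall>v\<in>verts G. degree G v = r)"

definition induced_subgraph :: "'v multigraph \<Rightarrow> 'v set \<Rightarrow> 'v multigraph" where
  "induced_subgraph G S =
     \<lparr>verts = S, edges = {#e \<in># edges G. set_uprod e \<subseteq> S#}\<rparr>"

definition reachable :: "'v multigraph \<Rightarrow> 'v \<Rightarrow> 'v \<Rightarrow> bool" where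
  "reachable G = (\<lambda>v w. Upair v w \<in># edges G)\<^sup>*\<^sup>*"

definition connected_components :: "'v multigraph \<Rightarrow> 'v multigraph set" where
  "connected_components G =
     {induced_subgraph G {y \<in> verts G. reachable G x y} |x. x \<in> verts G}"

definition graph_isomorphic :: "'v multigraph \<Rightarrow> 'w multigraph \<Rightarrow> bool" where
  "graph_isomorphic G H \<longleftrightarrow>
     (\<exists>f. bij_betw f (verts G) (verts H) \<and> image_mset (map_uprod f) (edges G) = edges H)"

text \<open>The vertex $v_i$ of the circulant graph is \<open>i\<close>.\<close>

definition circulant_graph :: "nat \<Rightarrow> nat multiset \<Rightarrow> nat multigraph" where
  "circulant_graph N M =
     \<lparr>verts = {..<N}, edges = (\<Sum>i<N. {#Upair i ((i + a) mod N). a \<in># M#})\<rparr>"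

definition symmetrized :: "'a word set \<Rightarrow> 'a word set" where
  "symmetrized R = {rotate k r |k r. r \<in> R \<union> inv_word ` R}"

text \<open>The word $x y^{-1} z$ gives an edge joining $x$ and $y$. A word is read cyclically, so that
  the word $x$ of length one has the end points $x$ and $x^{-1}$.\<close>

definition star_edge_ends :: "'a word \<Rightarrow> 'a letter uprod" where
  "star_edge_ends r = Upair (hd r) (inv_letter (hd (rotate1 r)))"

text \<open>For $r = x y^{-1} z$ this is $y x^{-1} z^{-1}$, namely the inverse $z^{-1} y x^{-1}$ of $r$
  with its last two letters moved to the front. For $r$ of length one it is the inverse of $r$.\<close>

definition star_partner :: "'a word \<Rightarrow> 'a word" where
  "star_partner r = rotate (length r - 2) (inv_word r)"

text \<open>For a finite presentation with non-empty cyclically reduced relators. There is one edge for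
  each class \<open>{r, star_partner r}\<close> of identified words; both words of a class have the same end
  points, so that \<open>the_elem\<close> is applied to a singleton.\<close>

definition star_graph :: "'a presentation \<Rightarrow> 'a letter multigraph" where
  "star_graph P =
     (case P of (X, R) \<Rightarrow>
       \<lparr>verts = letters X,
        edges = {#the_elem (star_edge_ends ` c).
                   c \<in># mset_set ((\<lambda>r. {r, star_partner r}) ` symmetrized R)#}\<rparr>)"

end

theory Submission
  imports Defs "HOL-Number_Theory.Cong"
begin

text \<open>As \<open>w\<close> is cyclically reduced, no cancellation takes place in
  $w = u\,\theta^h(u)\cdots$, so the cyclic shift of \<open>w\<close> by \<open>l(u)\<close> letters is $\theta^h(w)$.
  If some shorter cyclic shift of \<open>w\<close> were a shift $\theta^i(w)$, then, \<open>w\<close> not being a proper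
  power, it would yield a root shorter than \<open>u\<close>. Hence the cyclic permutations of the relators
  are the \<open>n * l(u)\<close> distinct words obtained by rotating $\theta^i(w)$ by \<open>k < l(u)\<close> places,
  and by orientability none of them is the inverse of another, so that each one gives exactly one
  edge of the star graph. Its end points are read off from the \<open>k\<close>-th two-letter subword of
  $u\,\theta^h(\iota(u))$, and regularity holds because this word has equally many changes of
  sign in both directions.

  For the components, the integers \<open>y\<close> such that every $x_i$ is joined to $x_{i+y}$ form a
  subgroup that contains the generators of \<open>d\<close>; conversely the residue modulo \<open>d\<close> of the
  subscript, taken relative to $q_0$ at the negative vertices, is constant along edges.\<close>

section \<open>Free reduction\<close>

lemma inv_letter_inv_letter [simp]: "inv_letter (inv_letter x) = x"
  by (cases x) auto

lemma inv_letter_eq_iff [simp]: "inv_letter x = inv_letter y \<longleftrightarrow> x = y"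
  by (metis inv_letter_inv_letter)

lemma reduced_Nil [simp]: "reduced []"
  by (simp add: reduced_def)

lemma reduced_Cons:
  "reduced (x # xs) \<longleftrightarrow> reduced xs \<and> (xs \<noteq> [] \<longrightarrow> hd xs \<noteq> inv_letter x)"
  by (cases xs) (auto simp: reduced_def)

lemma reduced_append:
  "reduced (xs @ ys) \<longleftrightarrow>
     reduced xs \<and> reduced ys \<and> (xs \<noteq> [] \<and> ys \<noteq> [] \<longrightarrow> hd ys \<noteq> inv_letter (last xs))"
  by (auto simp: reduced_def successively_append_iff)

lemma reduced_sublist: "sublist u w \<Longrightarrow> reduced w \<Longrightarrow> reduced u"
  by (auto simp: sublist_def reduced_append)

lemma reduced_cancel_cons: "reduced ys \<Longrightarrow> reduced (cancel_cons x ys)"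
  by (cases ys) (auto simp: reduced_Cons)

lemma reduced_foldr_cancel_cons: "reduced ys \<Longrightarrow> reduced (foldr cancel_cons xs ys)"
  by (induction xs) (auto intro: reduced_cancel_cons)

lemma reduced_free_reduce: "reduced (free_reduce w)"
  by (simp add: free_reduce_def reduced_foldr_cancel_cons)

lemma free_reduce_append: "free_reduce (xs @ ys) = foldr cancel_cons xs (free_reduce ys)"
  by (simp add: free_reduce_def)

lemma free_reduce_reduced: "reduced w \<Longrightarrow> free_reduce w = w"
proof (induction w)
  case (Cons x w)
  then show ?case
    by (cases w) (auto simp: free_reduce_def reduced_Cons)
qed (simp add: free_reduce_def)

text \<open>Reducedness matters when \<open>ys\<close> begins with \<open>x\<close>: the inner step
  then removes that letter, and putting \<open>x\<close> back must not cancel it against the next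
  one.\<close>

lemma cancel_cons_inv_letter:
  "reduced ys \<Longrightarrow> cancel_cons x (cancel_cons (inv_letter x) ys) = ys"
  by (cases ys rule: list.exhaust; cases "tl ys") (auto simp: reduced_Cons)

text \<open>Letters act on reduced words through \<open>cancel_cons\<close>, with \<open>x\<close>
  and \<open>inv_letter x\<close> acting as mutually inverse maps, so a cancellation inside the
  acting word does not change its action.\<close>

lemma foldr_cancel_cons_cancel_cons:
  assumes "reduced ys"
  shows "foldr cancel_cons (cancel_cons x xs) ys = cancel_cons x (foldr cancel_cons xs ys)"
proof (cases xs)
  case (Cons a xs')
  then show ?thesis
    using cancel_cons_inv_letter[OF reduced_foldr_cancel_cons[OF assms]] by auto
qed simp

text \<open>The words \<open>xs\<close> and \<open>free_reduce xs\<close> act alike on reduced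
  words. This is the associativity that allows part of a product to be reduced, or replaced by an
  equal element, before the whole.\<close>

lemma free_reduce_append_free_reduce_left:
  "free_reduce (free_reduce xs @ ys) = free_reduce (xs @ ys)"
proof -
  have "foldr cancel_cons (foldr cancel_cons xs []) zs = foldr cancel_cons xs zs"
    if "reduced zs" for zs
    using that by (induction xs) (auto simp: foldr_cancel_cons_cancel_cons)
  then show ?thesis
    by (metis free_reduce_append free_reduce_def reduced_free_reduce)
qed

lemma free_reduce_append_cong_left:
  "free_reduce xs = free_reduce xs' \<Longrightarrow> free_reduce (xs @ ys) = free_reduce (xs' @ ys)"
  by (metis free_reduce_append_free_reduce_left)

lemma free_reduce_append_cong_right:
  "free_reduce ys = free_reduce ys' \<Longrightarrow> free_reduce (xs @ ys) = free_reduce (xs @ ys')"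
  by (simp add: free_reduce_append)

lemma free_reduce_cancel_pair: "free_reduce (xs @ inv_letter x # x # ys) = free_reduce (xs @ ys)"
proof -
  have "free_reduce (inv_letter x # x # ys) = free_reduce ys"
    using cancel_cons_inv_letter[OF reduced_free_reduce, of "inv_letter x" ys]
    by (simp add: free_reduce_def)
  then show ?thesis by (rule free_reduce_append_cong_right)
qed

text \<open>Every block ends in the inverse of the first letter of the next block, so all inner
  letters \<open>a i\<close> cancel in pairs and only the outermost two survive.\<close>

lemma free_reduce_telescope:
  assumes "0 < p"
  shows "free_reduce (concat (map (\<lambda>i. a i # b i @ [inv_letter (a (Suc i))]) [0..<p])) =
         free_reduce (a 0 # concat (map b [0..<p]) @ [inv_letter (a p)])"
  using assms
proof (induction p rule: nat_induct_non_zero)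
  case (Suc p)
  have "free_reduce (concat (map (\<lambda>i. a i # b i @ [inv_letter (a (Suc i))]) [0..<Suc p])) =
    free_reduce ((a 0 # concat (map b [0..<p])) @ inv_letter (a p) # a p #
      b p @ [inv_letter (a (Suc p))])"
    using free_reduce_append_cong_left[OF Suc.IH] by simp
  also have "\<dots> = free_reduce (a 0 # concat (map b [0..<Suc p]) @ [inv_letter (a (Suc p))])"
    unfolding free_reduce_cancel_pair by simp
  finally show ?case .
qed simp

section \<open>Shifts of words\<close>

text \<open>A closed form of \<open>theta_letter n ^^ i\<close> on the letters of the free group.
  For \<open>i = 0\<close> it still reduces subscripts modulo \<open>n\<close>, so it is the
  identity only on \<open>letters {..<n}\<close>.\<close>

definition shift :: "nat \<Rightarrow> nat \<Rightarrow> nat letter \<Rightarrow> nat letter" where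
  "shift n i = map_letter (\<lambda>k. (k + i) mod n)"

lemma shift_simps [simp]:
  "shift n i (Pos k) = Pos ((k + i) mod n)" "shift n i (Neg k) = Neg ((k + i) mod n)"
  by (simp_all add: shift_def)

lemma shift_shift [simp]: "shift n i (shift n j x) = shift n (i + j) x"
  by (cases x; simp add: mod_simps; simp add: ac_simps)

lemma shift_comp_shift [simp]: "shift n i \<circ> shift n j = shift n (i + j)"
  by (simp add: fun_eq_iff)

lemma shift_cong: "[i = j] (mod n) \<Longrightarrow> shift n i = shift n j"
proof
  fix x
  assume "[i = j] (mod n)"
  then have "(k + i) mod n = (k + j) mod n" for k
    unfolding cong_def by (intro mod_add_cong) simp_all
  then show "shift n i x = shift n j x" by (cases x) auto
qed

lemma shift_mod [simp]: "shift n (i mod n) = shift n i"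
  by (rule shift_cong) simp

lemma letters_cases:
  assumes "x \<in> letters {..<n}"
  obtains k where "k < n" "x = Pos k" | k where "k < n" "x = Neg k"
  using assms by (auto simp: letters_def)

lemma shift_0: "x \<in> letters {..<n} \<Longrightarrow> shift n 0 x = x"
  by (elim letters_cases) auto

lemma shift_inv_letter [simp]: "shift n i (inv_letter x) = inv_letter (shift n i x)"
  by (cases x) auto

lemma shift_multiple: "x \<in> letters {..<n} \<Longrightarrow> n dvd i \<Longrightarrow> shift n i x = x"
  by (metis cong_0_iff shift_0 shift_cong)

lemma shift_in_letters: "0 < n \<Longrightarrow> shift n i x \<in> letters {..<n}"
  by (cases x) (auto simp: letters_def)

lemma map_shift_multiple:
  "set w \<subseteq> letters {..<n} \<Longrightarrow> n dvd i \<Longrightarrow> map (shift n i) w = w"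
  by (auto intro!: map_idI shift_multiple)

text \<open>The factor \<open>n - 1\<close> plays the part of -1 modulo \<open>n\<close>, which
  keeps the inverse shift within the natural numbers.\<close>

lemma map_shift_inverse:
  assumes "set w \<subseteq> letters {..<n}"
  shows "map (shift n ((n - 1) * i)) (map (shift n i) w) = w"
proof (cases "n = 0")
  case True
  then have "w = []" using assms by (cases w) (auto simp: letters_def)
  then show ?thesis by simp
next
  case False
  then have "(n - 1) * i + i = n * i" by (cases n) auto
  then show ?thesis
    by (simp only: map_map shift_comp_shift map_shift_multiple[OF assms] dvd_triv_left)
qed

lemma shift_eq_iff:
  "x \<in> letters {..<n} \<Longrightarrow> y \<in> letters {..<n} \<Longrightarrow> shift n i x = shift n i y \<longleftrightarrow> x = y"
  using map_shift_inverse[of "[x]" n i] map_shift_inverse[of "[y]" n i]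
  by (metis empty_set empty_subsetI insert_subset list.inject list.simps(15) list.simps(9))

lemma theta_funpow:
  assumes "set w \<subseteq> letters {..<n}"
  shows "(theta n ^^ i) w = map (shift n i) w"
proof (induction i)
  case 0
  then show ?case using map_shift_multiple[OF assms] by simp
next
  case (Suc i)
  have "theta_letter n = shift n 1"
  proof
    fix x show "theta_letter n x = shift n 1 x" by (cases x) auto
  qed
  then have "theta n = map (shift n 1)" by (auto simp: theta_def)
  then show ?case using Suc by simp
qed

text \<open>The product behind \<open>shift_product\<close> before free reduction, with the number
  \<open>p\<close> of factors left as a parameter.\<close>

definition shift_concat :: "nat \<Rightarrow> nat \<Rightarrow> nat \<Rightarrow> nat word \<Rightarrow> nat word" where
  "shift_concat n p h u = concat (map (\<lambda>i. map (shift n (i * h)) u) [0..<p])"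

lemma shift_concat_Nil [simp]: "shift_concat n p h [] = []"
  by (induction p) (simp_all add: shift_concat_def)

lemma free_reduce_Nil [simp]: "free_reduce [] = []"
  by (simp add: free_reduce_def)

lemma inv_letter_in_letters [simp]: "inv_letter x \<in> letters X \<longleftrightarrow> x \<in> letters X"
  by (cases x) (auto simp: letters_def)

lemma reduced_map_shift:
  assumes "reduced u" "set u \<subseteq> letters {..<n}"
  shows "reduced (map (shift n i) u)"
  using assms
proof (induction u)
  case (Cons x u)
  then show ?case
    using shift_eq_iff[of "hd u" n "inv_letter x" i]
    by (cases u) (auto simp: reduced_Cons)
qed simp

text \<open>Only the seams between consecutive factors could cancel, and each seam is a shift of the
  first one. The last letter is part of the claim so that the induction can see the seam with the
  next factor.\<close>

lemma reduced_shift_concat: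
  assumes "reduced u" "set u \<subseteq> letters {..<n}" "u \<noteq> []" "0 < p"
    and "last u \<noteq> inv_letter (shift n h (hd u))"
  shows "reduced (shift_concat n p h u) \<and> last (shift_concat n p h u) = shift n ((p - 1) * h) (last u)
     \<and> shift_concat n p h u \<noteq> []"
  using assms(4)
proof (induction p rule: nat_induct_non_zero)
  case 1
  then show ?case using assms by (simp add: shift_concat_def reduced_map_shift last_map)
next
  case (Suc p)
  have eq: "shift_concat n (Suc p) h u = shift_concat n p h u @ map (shift n (p * h)) u"
    by (simp add: shift_concat_def)
  have n: "0 < n" using assms(2,3) by (cases u) (auto simp: letters_def)
  \<comment> \<open>The seam before the new factor is the first seam shifted by
    \<open>(p - 1) * h\<close>, and shifts are injective.\<close>
  have "shift n (p * h) (hd u) \<noteq> inv_letter (shift n ((p - 1) * h) (last u))"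
  proof
    assume "shift n (p * h) (hd u) = inv_letter (shift n ((p - 1) * h) (last u))"
    moreover have "shift n (p * h) (hd u) = shift n ((p - 1) * h) (shift n h (hd u))"
      using Suc.hyps by (cases p) (auto simp: ac_simps)
    ultimately have "shift n ((p - 1) * h) (inv_letter (shift n h (hd u)))
       = shift n ((p - 1) * h) (last u)"
      by simp
    moreover have "inv_letter (shift n h (hd u)) \<in> letters {..<n}" "last u \<in> letters {..<n}"
      using assms(2,3) n by (auto simp: shift_in_letters)
    ultimately have "inv_letter (shift n h (hd u)) = last u"
      using shift_eq_iff by blast
    with assms(5) show False by simp
  qed
  then show ?case
    using Suc.IH assms(1-3) unfolding eq
    by (simp add: reduced_append reduced_map_shift hd_map last_map)
qed

lemma hd_shift_concat:
  assumes "u \<noteq> []" "set u \<subseteq> letters {..<n}" "0 < p"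
  shows "hd (shift_concat n p h u) = hd u"
proof -
  have "[0..<p] = 0 # [1..<p]" using assms(3) by (simp add: upt_conv_Cons)
  then show ?thesis
    using assms(1,2) by (simp add: shift_concat_def map_shift_multiple)
qed

text \<open>If the last letter of $u$ cancels against the first letter of $\theta^h(u)$, the product is
  $x \cdot v\,\theta^h(v)\cdots \cdot x^{-1}$, where $v$ is \<open>u\<close> without its first and last letters.\<close>

lemma free_reduce_shift_concat_ends:
  assumes "reduced u" "set u \<subseteq> letters {..<n}" "0 < p" "n dvd p * h" "u \<noteq> []"
  shows "free_reduce (shift_concat n p h u) = [] \<or>
    hd (free_reduce (shift_concat n p h u)) = hd u \<and>
    last (free_reduce (shift_concat n p h u)) = shift n ((p - 1) * h) (last u)"
  using assms(1,2,5)
proof (induction "length u" arbitrary: u rule: less_induct)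
  case less
  show ?case
  proof (cases "last u = inv_letter (shift n h (hd u))")
    case False
    have "reduced (shift_concat n p h u)"
      using reduced_shift_concat[OF less.prems assms(3) False] by blast
    then show ?thesis
      using reduced_shift_concat[OF less.prems assms(3) False] hd_shift_concat[of u n p h]
      less.prems assms(3) by (simp add: free_reduce_reduced)
  next
    case True
    define x where "x = hd u"
    \<comment> \<open>A shift keeps the sign of a letter, so a single letter is never the inverse of
      a shift of itself.\<close>
    have "tl u \<noteq> []"
    proof
      assume "tl u = []"
      then have "u = [x]" using less.prems(3) by (cases u) (auto simp: x_def)
      with True show False by (cases x) auto
    qed
    define v where "v = butlast (tl u)"
    have "last (tl u) = inv_letter (shift n h x)"
      using True \<open>tl u \<noteq> []\<close> by (simp add: last_tl x_def)
    then have u: "u = x # v @ [inv_letter (shift n h x)]"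
      using \<open>tl u \<noteq> []\<close> less.prems(3) append_butlast_last_id[of "tl u"] unfolding x_def v_def
      by (metis list.collapse)
    have x: "x \<in> letters {..<n}" and v: "set v \<subseteq> letters {..<n}" "reduced v"
      using less.prems(1,2) by (auto simp: u reduced_Cons reduced_append)
    have n: "0 < n" using x by (auto simp: letters_def)
    \<comment> \<open>Block \<open>i\<close> now ends in the inverse of the letter that opens block
      \<open>i + 1\<close>, which is the form that telescopes.\<close>
    have "shift_concat n p h u = concat (map (\<lambda>i. shift n (i * h) x # map (shift n (i * h)) v @
        [inv_letter (shift n (Suc i * h) x)]) [0..<p])"
      unfolding shift_concat_def u by (simp add: ac_simps)
    then have "free_reduce (shift_concat n p h u) =
       free_reduce (shift n (0 * h) x # shift_concat n p h v @ [inv_letter (shift n (p * h) x)])"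
      using free_reduce_telescope[OF assms(3), of "\<lambda>i. shift n (i * h) x"
        "\<lambda>i. map (shift n (i * h)) v"]
      by (simp add: shift_concat_def)
    also have "\<dots> = free_reduce ((x # shift_concat n p h v) @ [inv_letter x])"
      using shift_multiple[OF x assms(4)] shift_0[OF x] by simp
    also have "\<dots> = free_reduce (x # free_reduce (shift_concat n p h v) @ [inv_letter x])"
    proof -
      have "free_reduce (shift_concat n p h v @ [inv_letter x]) =
        free_reduce (free_reduce (shift_concat n p h v) @ [inv_letter x])"
        by (simp add: free_reduce_append_free_reduce_left)
      from free_reduce_append_cong_right[OF this, of "[x]"] show ?thesis by simp
    qed
    finally have eq: "free_reduce (shift_concat n p h u) =
       free_reduce (x # free_reduce (shift_concat n p h v) @ [inv_letter x])" .
    show ?thesis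
    proof (cases "free_reduce (shift_concat n p h v) = []")
      case True
      then show ?thesis by (simp add: eq) (simp add: free_reduce_def)
    next
      case nonempty: False
      then have "v \<noteq> []" by auto
      have ends: "hd (free_reduce (shift_concat n p h v)) = hd v"
          "last (free_reduce (shift_concat n p h v)) = shift n ((p - 1) * h) (last v)"
        using less.hyps[of v] v nonempty \<open>v \<noteq> []\<close> by (auto simp: u)
      have "hd v \<noteq> inv_letter x" "last v \<noteq> shift n h x"
        using less.prems(1) \<open>v \<noteq> []\<close> by (auto simp: u reduced_Cons reduced_append)
      \<comment> \<open>As \<open>n\<close> divides \<open>p * h\<close>, the shift by
        \<open>(p - 1) * h\<close> undoes the shift by \<open>h\<close>. This carries the absence of
        cancellation at the right end of \<open>v\<close> inside \<open>u\<close> over to the right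
        end of the product.\<close>
      have "(p - 1) * h + h = p * h"
        using assms(3) by (cases p) auto
      then have *: "shift n ((p - 1) * h) (shift n h x) = x"
        using assms(4) x by (simp add: shift_multiple)
      have "shift n ((p - 1) * h) (last v) \<noteq> shift n ((p - 1) * h) (shift n h x)"
        using \<open>last v \<noteq> shift n h x\<close> v(1) \<open>v \<noteq> []\<close> n shift_in_letters[OF n, of h x]
          shift_eq_iff[of "last v" n "shift n h x"] by (metis last_in_set subsetD)
      then have "shift n ((p - 1) * h) (last v) \<noteq> x" using * by simp
      then have "reduced (x # free_reduce (shift_concat n p h v) @ [inv_letter x])"
        using nonempty ends \<open>hd v \<noteq> inv_letter x\<close>
        by (auto simp: reduced_Cons reduced_append reduced_free_reduce)
      then show ?thesis
        unfolding eq using * by (simp add: free_reduce_reduced u)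
    qed
  qed
qed

text \<open>If the seams cancelled, the reduced product would still begin with \<open>hd u\<close>
  and end with the shift of \<open>last u\<close> by \<open>(p - 1) * h\<close>. These two letters
  would then be mutually inverse, contrary to cyclic reducedness.\<close>

lemma cyclically_reduced_shift_concat:
  assumes "reduced u" "set u \<subseteq> letters {..<n}" "0 < p" "n dvd p * h"
    and "w = free_reduce (shift_concat n p h u)" "w \<noteq> []" "cyclically_reduced w"
  shows "w = shift_concat n p h u"
proof -
  have "u \<noteq> []" using assms(5,6) by auto
  have "last u \<noteq> inv_letter (shift n h (hd u))"
  proof
    assume *: "last u = inv_letter (shift n h (hd u))"
    have "hd w = hd u" "last w = shift n ((p - 1) * h) (last u)"
      using free_reduce_shift_concat_ends[OF assms(1-4) \<open>u \<noteq> []\<close>] assms(5,6) by auto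
    moreover have "(p - 1) * h + h = p * h"
      using assms(3) by (cases p) auto
    then have "shift n ((p - 1) * h) (last u) = inv_letter (hd u)"
      using assms(2-4) \<open>u \<noteq> []\<close> unfolding *
      by (auto intro!: shift_multiple)
    ultimately show False using assms(6,7) by (auto simp: cyclically_reduced_def)
  qed
  then have "reduced (shift_concat n p h u)"
    using reduced_shift_concat assms(1-3) \<open>u \<noteq> []\<close> by blast
  then show ?thesis by (simp add: assms(5) free_reduce_reduced)
qed

section \<open>Words whose rotations are shifts\<close>

lemma rotate_eq_rotate_iff: "rotate k xs = rotate k ys \<longleftrightarrow> xs = ys"
  using inj_rotate1 by (induction k) (auto dest: injD)

lemma rotate_mult_shift:
  assumes "rotate k w = map (shift n i) w" "set w \<subseteq> letters {..<n}"
  shows "rotate (q * k) w = map (shift n (q * i)) w"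
proof (induction q)
  case 0
  show ?case using map_shift_multiple[OF assms(2)] by simp
next
  case (Suc q)
  have "rotate (Suc q * k) w = rotate k (rotate (q * k) w)"
    by (simp add: rotate_rotate)
  also have "\<dots> = map (shift n (q * i)) (rotate k w)"
    by (simp add: Suc rotate_map)
  also have "\<dots> = map (shift n (Suc q * i)) w"
    by (simp add: assms(1) add.commute)
  finally show ?case .
qed

text \<open>By Bezout some multiple of \<open>k\<close> is congruent to the gcd modulo
  \<open>length w\<close>, and multiples of the rotation are multiples of the shift.\<close>

lemma rotate_gcd_shift:
  assumes "rotate k w = map (shift n i) w" "set w \<subseteq> letters {..<n}" "0 < k"
  obtains q where "rotate (gcd k (length w)) w = map (shift n (q * i)) w"
proof -
  obtain x y where xy: "k * x = length w * y + gcd k (length w)"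
    using bezout_nat[of k "length w"] assms(3) by auto
  have "rotate (x * k) w = rotate (gcd k (length w) + length w * y) w"
    using xy by (simp only: ac_simps)
  also have "\<dots> = rotate (gcd k (length w)) (rotate (length w * y) w)"
    by (simp only: rotate_rotate)
  also have "\<dots> = rotate (gcd k (length w)) w"
    by simp
  finally show ?thesis
    using that[of x] rotate_mult_shift[OF assms(1,2), of x] by simp
qed

text \<open>Rotating by \<open>q * k\<close> amounts to shifting by \<open>q * i\<close>, so the
  block of \<open>w\<close> at position \<open>q * k\<close> is that shift of the first
  block.\<close>

lemma eq_shift_concat_take:
  assumes "rotate k w = map (shift n i) w" "set w \<subseteq> letters {..<n}" "length w = m * k"
  shows "w = shift_concat n m i (take k w)"
proof -
  have "shift_concat n q i (take k w) = take (q * k) w" if "q \<le> m" for q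
    using that
  proof (induction q)
    case (Suc q)
    have len: "q * k + k \<le> length w"
      using mult_le_mono1[OF Suc.prems, of k] assms(3) by simp
    have "map (shift n (q * i)) (take k w) = take k (rotate (q * k) w)"
      by (simp add: rotate_mult_shift[OF assms(1,2)] take_map)
    also have "\<dots> = take k (drop (q * k) w)"
    proof (cases "q * k < length w")
      case True
      then show ?thesis using len by (simp add: rotate_drop_take)
    next
      \<comment> \<open>Here \<open>len\<close> forces \<open>k = 0\<close>, and both sides are
        empty.\<close>
      case False
      then show ?thesis using len by simp
    qed
    finally show ?case
      using Suc by (simp add: shift_concat_def take_add add.commute[of k])
  qed (simp add: shift_concat_def)
  from this[of m] show ?thesis by (simp add: assms(3))
qed

lemma length_shift_concat [simp]: "length (shift_concat n p h u) = p * length u"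
  by (induction p) (simp_all add: shift_concat_def)

lemma prefix_shift_concat:
  assumes "set u \<subseteq> letters {..<n}" "0 < p"
  shows "prefix u (shift_concat n p h u)"
proof -
  have "[0..<p] = 0 # [1..<p]" using assms(2) by (simp add: upt_conv_Cons)
  then show ?thesis
    using assms(1) by (simp add: shift_concat_def map_shift_multiple)
qed

text \<open>The shift by \<open>h\<close> turns each factor into the next one. The last becomes the
  shift of \<open>u\<close> by \<open>p * h\<close>, which is \<open>u\<close> itself, now standing
  at the end.\<close>

lemma rotate_shift_concat:
  assumes "set u \<subseteq> letters {..<n}" "0 < p" "n dvd p * h"
  shows "rotate (length u) (shift_concat n p h u) = map (shift n h) (shift_concat n p h u)"
proof -
  obtain q where q: "p = Suc q" using assms(2) by (cases p) auto
  define v where "v = concat (map (\<lambda>i. map (shift n (Suc i * h)) u) [0..<q])"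
  have "[0..<Suc q] = 0 # map Suc [0..<q]"
    by (simp add: map_Suc_upt upt_conv_Cons del: upt_Suc)
  then have "shift_concat n p h u = u @ v"
    using map_shift_multiple[OF assms(1), of 0]
    by (simp add: shift_concat_def q v_def comp_def del: upt_Suc)
  moreover have "map (shift n h) (shift_concat n p h u) =
      concat (map (\<lambda>i. map (shift n (Suc i * h)) u) [0..<Suc q])"
    by (simp add: shift_concat_def q map_concat comp_def del: upt_Suc)
  then have "map (shift n h) (shift_concat n p h u) = v @ map (shift n (p * h)) u"
    by (simp add: v_def q)
  ultimately show ?thesis
    using map_shift_multiple[OF assms(1,3)] by (simp add: rotate_append)
qed

text \<open>With \<open>K = gcd k (length w)\<close>, the rotation by \<open>K\<close> fixes
  \<open>w\<close> too, so \<open>w\<close> is a power of its first \<open>K\<close> letters. The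
  exponent is at least 2 because \<open>length w\<close> does not divide \<open>k\<close>.\<close>

lemma proper_power_if_rotate:
  fixes n :: nat
  assumes "reduced w" "set w \<subseteq> letters {..<n}" "w \<noteq> []" "rotate k w = w" "\<not> length w dvd k"
  shows "proper_power {..<n} w"
proof -
  define K where "K = gcd k (length w)"
  have "0 < k" using assms(5) by (cases k) auto
  have "rotate k w = map (shift n 0) w"
    using assms(2,4) by (simp add: map_shift_multiple)
  then obtain q where "rotate K w = map (shift n (q * 0)) w"
    unfolding K_def using rotate_gcd_shift assms(2) \<open>0 < k\<close> by metis
  then have *: "rotate K w = map (shift n 0) w" by simp
  have "K dvd length w" "K \<noteq> length w" 
    using assms(5) unfolding K_def by (auto, metis gcd_dvd1)
  then obtain m where m: "length w = m * K"
    by (metis dvdE mult.commute)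
  have "m \<noteq> 0" "m \<noteq> 1" using m assms(3) \<open>K \<noteq> length w\<close> by (metis length_0_conv mult_0, metis mult_1)
  have "set (take K w) \<subseteq> letters {..<n}"
    using assms(2) by (meson order.trans set_take_subset)
  moreover have "reduced (take K w)"
    using assms(1) by (meson reduced_sublist sublist_take)
  moreover have "w = concat (replicate m (take K w))"
  proof -
    have "w = shift_concat n m 0 (take K w)"
      by (rule eq_shift_concat_take[OF * assms(2) m])
    also have "\<dots> = concat (map (\<lambda>i. take K w) [0..<m])"
      using \<open>set (take K w) \<subseteq> _\<close>
      by (simp add: shift_concat_def map_shift_multiple)
    finally show ?thesis by (simp add: map_replicate_const)
  qed
  ultimately show ?thesis
    using \<open>m \<noteq> 0\<close> \<open>m \<noteq> 1\<close> assms(1) unfolding proper_power_def free_group_def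
    by (intro bexI[of _ "take K w"] exI[of _ m]) (auto simp: free_reduce_reduced)
qed

section \<open>Shift roots obtained from rotations\<close>

lemma shift_product_eq:
  "set u \<subseteq> letters {..<n} \<Longrightarrow>
    shift_product n u h = free_reduce (shift_concat n (n div gcd n h) h u)"
  by (simp add: shift_product_def shift_concat_def theta_funpow)

text \<open>The quotient \<open>n div gcd n h\<close> is the additive order of \<open>h\<close>
  modulo \<open>n\<close>.\<close>

lemma order_dvd_iff:
  assumes "0 < (n::nat)"
  shows "n div gcd n h dvd k \<longleftrightarrow> n dvd k * h"
proof -
  obtain a b where "n = a * gcd n h" "h = b * gcd n h" "coprime a b"
    using gcd_coprime_exists[of n h] assms by auto
  then show ?thesis
    using assms
    by (metis coprime_dvd_mult_left_iff dvd_times_right_cancel_iff gcd_pos_nat mult.assoc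
      nonzero_mult_div_cancel_right not_gr_zero)
qed

text \<open>The residues modulo \<open>n\<close> act freely by shifts: the subscript of the first
  letter already determines the shift.\<close>

lemma map_shift_eq_iff:
  assumes "set w \<subseteq> letters {..<n}" "w \<noteq> []"
  shows "map (shift n i) w = map (shift n j) w \<longleftrightarrow> [i = j] (mod n)"
proof
  assume "map (shift n i) w = map (shift n j) w"
  then have "shift n i (hd w) = shift n j (hd w)"
    using assms(2) by (cases w) auto
  then show "[i = j] (mod n)"
    by (cases "hd w") (auto simp: cong_add_lcancel_nat simp flip: cong_def)
qed (metis shift_cong)

text \<open>The root is formed by the first \<open>K = gcd k (length w)\<close> letters. Its number
  \<open>m\<close> of factors must be the order of \<open>h\<close> modulo \<open>n\<close>. Indeed,
  the rotation by \<open>j * K\<close> fixes \<open>w\<close> exactly if \<open>m dvd j\<close>,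
  since \<open>w\<close> is not a proper power, and exactly if \<open>n dvd j * h\<close>, since it
  equals the shift by \<open>j * h\<close>.\<close>

lemma ex_shift_root_le:
  assumes "reduced w" "set w \<subseteq> letters {..<n}" "w \<noteq> []" "\<not> proper_power {..<n} w"
    and "rotate k w = map (shift n i) w" "0 < k"
  shows "\<exists>u h. shift_root n w u h \<and> length u \<le> k"
proof -
  have n: "0 < n" using assms(2,3) by (cases w) (auto simp: letters_def)
  define K where "K = gcd k (length w)"
  obtain q where "rotate K w = map (shift n (q * i)) w"
    unfolding K_def using rotate_gcd_shift[OF assms(5,2,6)] by metis
  moreover define h where "h = q * i mod n"
  ultimately have K: "rotate K w = map (shift n h) w"
    by (simp add: h_def)
  have "K dvd length w" "K \<le> k" "0 < K"
    using assms(6) by (auto simp: K_def)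
  then obtain m where m: "length w = m * K"
    by (metis dvdE mult.commute)
  have "m dvd j \<longleftrightarrow> n dvd j * h" for j
  proof -
    have "m dvd j \<longleftrightarrow> length w dvd j * K"
      using \<open>0 < K\<close> by (simp add: m)
    also have "\<dots> \<longleftrightarrow> rotate (j * K) w = w"
      using proper_power_if_rotate[OF assms(1-3)] assms(4) by (auto simp: dvd_eq_mod_eq_0)
    also have "\<dots> \<longleftrightarrow> map (shift n (j * h)) w = map (shift n 0) w"
      using rotate_mult_shift[OF K assms(2)] assms(2) by (simp add: map_shift_multiple)
    also have "\<dots> \<longleftrightarrow> n dvd j * h"
      unfolding map_shift_eq_iff[OF assms(2,3)] by (simp add: cong_0_iff)
    finally show ?thesis .
  qed
  then have "m dvd j \<longleftrightarrow> n div gcd n h dvd j" for j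
    by (simp add: order_dvd_iff[OF n])
  then have "m = n div gcd n h"
    by (meson dvd_antisym dvd_refl)
  then have "w = shift_concat n (n div gcd n h) h (take K w)"
    using eq_shift_concat_take[OF K assms(2) m] by simp
  then have "shift_root n w (take K w) h"
    unfolding shift_root_def using n assms(1,2)
    by (metis free_reduce_reduced h_def mod_less_divisor order.trans set_take_subset
        shift_product_eq sublist_take)
  then show ?thesis
    using \<open>K \<le> k\<close> by (intro exI conjI) auto
qed

section \<open>The edges of the star graph\<close>

lemma inv_word_inv_word [simp]: "inv_word (inv_word w) = w"
  by (simp add: inv_word_def rev_map comp_def)

lemma length_inv_word [simp]: "length (inv_word w) = length w"
  by (simp add: inv_word_def)

lemma inv_word_Nil_iff [simp]: "inv_word w = [] \<longleftrightarrow> w = []"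
  by (simp add: inv_word_def)

lemma map_shift_inv_word: "map (shift n i) (inv_word w) = inv_word (map (shift n i) w)"
  by (simp add: inv_word_def rev_map comp_def)

text \<open>Inversion reverses the direction of a rotation; the subtraction expresses
  \<open>-k\<close> modulo \<open>length w\<close> by a natural number.\<close>

lemma rotate_inv_word: "rotate k (inv_word w) = inv_word (rotate (length w - k mod length w) w)"
  by (simp add: inv_word_def rotate_rev rotate_map)

lemma inv_word_rotate: "inv_word (rotate k w) = rotate (length w - k mod length w) (inv_word w)"
proof (cases "k mod length w = 0")
  case True
  then show ?thesis by simp
next
  case False
  show ?thesis
  proof (cases "w = []")
    case True
    then show ?thesis by simp
  next
    case nonempty: False
    then have "length w - (length w - k mod length w) mod length w = k mod length w"
      using False mod_less_divisor[of "length w" k] by simp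
    then show ?thesis
      by (simp add: rotate_inv_word flip: rotate_conv_mod)
  qed
qed

text \<open>The two rotations add up to one full turn. Truncated subtraction makes this true for
  lengths below 2 as well.\<close>

lemma star_partner_star_partner [simp]: "star_partner (star_partner r) = r"
proof -
  have "star_partner (star_partner r) =
      rotate (length r - 2 + (length r - (length r - 2) mod length r)) r"
    by (simp add: star_partner_def rotate_inv_word rotate_rotate)
  also have "length r - 2 + (length r - (length r - 2) mod length r) = length r"
    by (cases "length r"; cases "length r - 1") auto
  also have "rotate (length r) r = r" by simp
  finally show ?thesis .
qed

lemma star_edge_ends_nth:
  "r \<noteq> [] \<Longrightarrow> star_edge_ends r = Upair (r ! 0) (inv_letter (r ! (1 mod length r)))"
  by (simp add: star_edge_ends_def hd_conv_nth nth_rotate1)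

lemma inv_word_nth: "j < length w \<Longrightarrow> inv_word w ! j = inv_letter (w ! (length w - Suc j))"
  by (simp add: inv_word_def rev_nth)

text \<open>Passing to the partner exchanges the two end points. Hence \<open>the_elem\<close> in
  \<open>star_graph\<close> is applied to a singleton.\<close>

lemma star_edge_ends_star_partner [simp]:
  assumes "r \<noteq> []"
  shows "star_edge_ends (star_partner r) = star_edge_ends r"
proof (cases "length r = 1")
  case True
  then show ?thesis
    using assms by (auto simp: star_partner_def star_edge_ends_nth inv_word_nth length_Suc_conv)
next
  case False
  then obtain m where m: "length r = Suc (Suc m)"
    using assms by (cases r; cases "tl r") auto
  then show ?thesis
    using assms by (simp add: star_partner_def star_edge_ends_nth inv_word_nth nth_rotate)
qed

lemma image_mset_mset_set_sum: "image_mset f (mset_set A) = (\<Sum>x\<in>A. {#f x#})"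
  by (induction A rule: infinite_finite_induct) auto

section \<open>Cyclic permutations of the relators and the edges they give\<close>

locale shift_presentation =
  fixes n h :: nat and w u :: "nat word"
  assumes w_free_group: "w \<in> free_group {..<n}"
    and w_nonempty: "w \<noteq> []"
    and cyclically_reduced_w: "cyclically_reduced w"
    and not_proper_power_w: "\<not> proper_power {..<n} w"
    and orientable_w: "orientable n w"
    and shortest_root: "shortest_shift_root n w u h"
begin

lemma set_w: "set w \<subseteq> letters {..<n}" and reduced_w: "reduced w"
  using w_free_group by (auto simp: free_group_def)

lemma n_pos: "0 < n"
  using set_w w_nonempty by (cases w) (auto simp: letters_def)

lemma root: "h < n" "sublist u w" "w = shift_product n u h"
  using shortest_root by (auto simp: shortest_shift_root_def shift_root_def)

lemma set_u: "set u \<subseteq> letters {..<n}"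
  using root(2) set_w set_mono_sublist by blast

definition p where "p = n div gcd n h"

lemma p_pos: "0 < p"
  using n_pos by (simp add: p_def div_greater_zero_iff gcd_le1_nat)

lemma n_dvd_p_h: "n dvd p * h"
  using order_dvd_iff[OF n_pos, of h p] by (simp add: p_def)

lemma w_eq: "w = shift_concat n p h u"
  using cyclically_reduced_shift_concat[OF _ set_u p_pos n_dvd_p_h _ w_nonempty cyclically_reduced_w]
    root(3) reduced_sublist[OF root(2) reduced_w] by (simp add: shift_product_eq[OF set_u] p_def)

lemma u_nonempty: "u \<noteq> []"
  using w_eq w_nonempty by auto

lemma rotate_length_u: "rotate (length u) w = map (shift n h) w"
  unfolding w_eq by (rule rotate_shift_concat[OF set_u p_pos n_dvd_p_h])

text \<open>This is the form in which the minimality of \<open>u\<close> is used: a shorter positive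
  rotation that is a shift would produce a shorter root.\<close>

lemma length_u_le_if_rotate:
  assumes "rotate k w = map (shift n i) w" "0 < k"
  shows "length u \<le> k"
  using ex_shift_root_le[OF reduced_w set_w w_nonempty not_proper_power_w assms] shortest_root
  by (fastforce simp: shortest_shift_root_def)

text \<open>For \<open>k \<le> m\<close>, cancelling the common rotation shows that rotating
  \<open>w\<close> by \<open>m - k < length u\<close> is a shift, so \<open>k = m\<close> by
  minimality of \<open>u\<close>. Then \<open>i = j\<close> because shifts act freely.\<close>

lemma rotate_shift_inject:
  assumes "i < n" "j < n" "k < length u" "m < length u"
    and "rotate k (map (shift n i) w) = rotate m (map (shift n j) w)"
  shows "i = j \<and> k = m"
proof -
  have *: "i = j \<and> k = m"
    if le: "k \<le> m" and b: "i < n" "j < n" "m < length u"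
      and eq: "rotate k (map (shift n i) w) = rotate m (map (shift n j) w)"
    for i j k m
  proof -
    have "rotate k (map (shift n i) w) = rotate k (rotate (m - k) (map (shift n j) w))"
      using le eq by (simp add: rotate_rotate)
    then have "map (shift n i) w = rotate (m - k) (map (shift n j) w)"
      by (simp only: rotate_eq_rotate_iff)
    then have e: "map (shift n i) w = map (shift n j) (rotate (m - k) w)"
      by (simp only: rotate_map)
    have "map (shift n ((n - 1) * j)) (map (shift n j) (rotate (m - k) w)) = rotate (m - k) w"
      using set_w by (intro map_shift_inverse) simp
    then have "rotate (m - k) w = map (shift n ((n - 1) * j + i)) w"
      unfolding e[symmetric] by (simp only: map_map shift_comp_shift)
    then have "k = m"
      using length_u_le_if_rotate[of "m - k"] le b by fastforce
    then have "map (shift n i) w = map (shift n j) w"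
      using e by simp
    then show ?thesis
      using \<open>k = m\<close> b map_shift_eq_iff[OF set_w w_nonempty] by (simp add: cong_less_modulus_unique_nat)
  qed
  show ?thesis
    using *[of k m i j] *[of m k j i] assms by (cases "k \<le> m") auto
qed

text \<open>The rotation \<open>k\<close> is unbounded here, which makes closure under rotation
  immediate; a parametrisation without repetitions follows in \<open>rotations_eq\<close> and
  \<open>inj_on_rotations\<close>.\<close>

definition rotations :: "nat word set" where
  "rotations = {rotate k (map (shift n i) w) |k i. i < n}"

lemma rotate_shift_in_rotations: "rotate k (map (shift n i) w) \<in> rotations"
proof -
  have "rotate k (map (shift n i) w) = rotate k (map (shift n (i mod n)) w)" by simp
  then show ?thesis
    using mod_less_divisor[OF n_pos, of i] unfolding rotations_def by blast
qed

lemma rotate_in_rotations: "r \<in> rotations \<Longrightarrow> rotate k r \<in> rotations"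
  by (auto simp: rotations_def rotate_rotate) blast

text \<open>A rotation by \<open>length u\<close> can be traded for a shift by \<open>h\<close>, so
  \<open>k\<close> may be reduced modulo \<open>length u\<close>.\<close>

lemma rotations_eq:
  "rotations = (\<lambda>(i, k). rotate k (map (shift n i) w)) ` ({..<n} \<times> {..<length u})"
proof (intro equalityI subsetI)
  fix r assume "r \<in> rotations"
  then obtain k i where r: "r = rotate k (map (shift n i) w)" "i < n"
    by (auto simp: rotations_def)
  define l q where "l = k mod length u" and "q = k div length u"
  have "k = l + q * length u" by (simp add: l_def q_def)
  then have "r = rotate l (map (shift n i) (rotate (q * length u) w))"
    unfolding r(1) by (simp add: rotate_rotate flip: rotate_map)
  also have "\<dots> = rotate l (map (shift n (i + q * h)) w)"
    by (simp add: rotate_mult_shift[OF rotate_length_u set_w])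
  also have "\<dots> = rotate l (map (shift n ((i + q * h) mod n)) w)"
    by simp
  finally show "r \<in> (\<lambda>(i, k). rotate k (map (shift n i) w)) ` ({..<n} \<times> {..<length u})"
    using n_pos u_nonempty
    by (intro rev_image_eqI[of "((i + q * h) mod n, l)"]) (auto simp: l_def)
qed (auto simp: rotations_def)

lemma inj_on_rotations:
  "inj_on (\<lambda>(i, k). rotate k (map (shift n i) w)) ({..<n} \<times> {..<length u})"
  using rotate_shift_inject by (fastforce simp: inj_on_def)

lemma finite_rotations: "finite rotations"
  by (simp add: rotations_eq)

text \<open>If both words were rotations of shifts of \<open>w\<close>, solving for \<open>w\<close>
  would exhibit it as a cyclic permutation of the inverse of one of its shifts, against
  orientability.\<close>

lemma rotations_inv_word_disjoint:
  assumes "r \<in> rotations"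
  shows "inv_word r \<notin> rotations"
proof
  assume "inv_word r \<in> rotations"
  then obtain k i where "inv_word r = rotate k (map (shift n i) w)"
    by (auto simp: rotations_def)
  then have r: "r = inv_word (rotate k (map (shift n i) w))" by (metis inv_word_inv_word)
  obtain m j where r': "r = rotate m (map (shift n j) w)"
    using assms by (auto simp: rotations_def)
  define L where "L = length w"
  have "0 < L" using w_nonempty by (simp add: L_def)
  \<comment> \<open>\<open>k'\<close> stands for \<open>-k\<close> modulo \<open>L\<close>, and
    \<open>i'\<close> for \<open>i - j\<close> modulo \<open>n\<close>; the latter is reduced below
    \<open>n\<close> later because \<open>orientable\<close> asks for it.\<close>
  define k' where "k' = L - k mod L"
  define i' where "i' = (n - 1) * j + i"
  have "rotate m w = map (shift n ((n - 1) * j)) r"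
    unfolding r' rotate_map[symmetric] map_shift_inverse[OF set_w] ..
  also have "\<dots> = rotate k' (inv_word (map (shift n i') w))"
    unfolding r inv_word_rotate k'_def i'_def L_def
    by (simp add: map_shift_inv_word flip: rotate_map)
  also have "\<dots> = rotate k' (inv_word (map (shift n (i' mod n)) w))"
    using map_shift_eq_iff[OF set_w w_nonempty, of i' "i' mod n"] by simp
  finally have "rotate (L - m mod L) (rotate m w) =
      rotate (L - m mod L + k') (inv_word (map (shift n (i' mod n)) w))"
    by (simp add: rotate_rotate)
  moreover have "rotate (L - m mod L) (rotate m w) = w"
  proof -
    have "rotate m w = rotate (m mod L) w"
      unfolding L_def by (rule rotate_conv_mod)
    then show ?thesis
      using \<open>0 < L\<close> by (simp add: rotate_rotate less_imp_le) (simp add: L_def)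
  qed
  ultimately show False
    using orientable_w n_pos unfolding orientable_def theta_funpow[OF set_w]
    by (metis mod_less_divisor)
qed

lemma symmetrized_eq:
  "symmetrized {(theta n ^^ i) w |i. i < n} = rotations \<union> inv_word ` rotations"
proof -
  have eq: "{(theta n ^^ i) w |i. i < n} = {map (shift n i) w |i. i < n}"
    by (simp add: theta_funpow[OF set_w])
  show ?thesis
    unfolding eq symmetrized_def
  proof (intro equalityI subsetI)
    fix r
    assume "r \<in> rotations \<union> inv_word ` rotations"
    then consider k i where "i < n" "r = rotate k (map (shift n i) w)"
      | k i where "i < n" "r = inv_word (rotate k (map (shift n i) w))"
      by (auto simp: rotations_def)
    then show "r \<in> {rotate k r |k r. r \<in> {map (shift n i) w |i. i < n} \<union>
        inv_word ` {map (shift n i) w |i. i < n}}"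
      unfolding inv_word_rotate by cases blast+
  next
    fix r
    assume "r \<in> {rotate k r |k r. r \<in> {map (shift n i) w |i. i < n} \<union>
        inv_word ` {map (shift n i) w |i. i < n}}"
    then consider k i where "i < n" "r = rotate k (map (shift n i) w)"
      | k i where "i < n" "r = rotate k (inv_word (map (shift n i) w))"
      by auto
    then show "r \<in> rotations \<union> inv_word ` rotations"
      by cases (auto simp: rotate_shift_in_rotations rotate_inv_word)
  qed
qed

lemma star_partner_rotations:
  "r \<in> rotations \<Longrightarrow> star_partner r \<in> inv_word ` rotations"
  by (simp add: star_partner_def rotate_inv_word rotate_in_rotations)

lemma star_partner_inv_rotations:
  "r \<in> rotations \<Longrightarrow> star_partner (inv_word r) \<in> rotations"
  by (simp add: star_partner_def rotate_in_rotations)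

text \<open>The map \<open>star_partner\<close> interchanges \<open>rotations\<close> and the
  inverses of its members, two disjoint sets. Every class of identified words therefore contains
  exactly one member of \<open>rotations\<close>.\<close>

lemma edges_star_graph_rotations:
  "edges (star_graph (cyclic_presentation n w)) = image_mset star_edge_ends (mset_set rotations)"
proof -
  have classes: "(\<lambda>r. {r, star_partner r}) ` (rotations \<union> inv_word ` rotations) =
      (\<lambda>r. {r, star_partner r}) ` rotations"
  proof -
    have "{inv_word r, star_partner (inv_word r)} \<in> (\<lambda>r. {r, star_partner r}) ` rotations"
      if "r \<in> rotations" for r
      using star_partner_inv_rotations[OF that]
      by (intro rev_image_eqI[of "star_partner (inv_word r)"]) auto
    then show ?thesis by auto
  qed
  have "star_partner r \<notin> rotations" if "r \<in> rotations" for r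
    using star_partner_rotations[OF that] rotations_inv_word_disjoint by auto
  then have inj: "inj_on (\<lambda>r. {r, star_partner r}) rotations"
    by (intro inj_onI) (auto simp: doubleton_eq_iff)
  have nonempty: "r \<noteq> []" if "r \<in> rotations" for r
    using that w_nonempty by (auto simp: rotations_def)
  have "edges (star_graph (cyclic_presentation n w)) =
      image_mset (\<lambda>r. the_elem (star_edge_ends ` {r, star_partner r})) (mset_set rotations)"
    unfolding star_graph_def cyclic_presentation_def
    by (simp add: symmetrized_eq classes image_mset_mset_set[OF inj, symmetric] image_mset.compositionality comp_def)
  also have "\<dots> = image_mset star_edge_ends (mset_set rotations)"
    using finite_rotations nonempty by (intro image_mset_cong) auto
  finally show ?thesis .
qed

lemma two_subwords_eq:
  "two_subwords n u h = zip (u @ [shift n h (hd u)]) (tl u @ [shift n h (hd u)])"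
  using set_u u_nonempty theta_funpow[of "[hd u]" n h] by (simp add: two_subwords_def Let_def subset_iff)

lemma length_two_subwords [simp]: "length (two_subwords n u h) = length u"
  using u_nonempty by (simp add: two_subwords_eq)

lemma length_u_le: "length u \<le> length w"
  using w_eq p_pos
  by (metis length_shift_concat le_add1 mult.commute mult_le_mono2 mult_1_right Suc_leI One_nat_def)

lemma nth_u: "k < length u \<Longrightarrow> u ! k = w ! k"
  using prefix_shift_concat[OF set_u p_pos, of h] unfolding w_eq[symmetric]
  by (auto simp: prefix_def nth_append)

lemma nth_two_subwords:
  assumes "k < length u"
  shows "two_subwords n u h ! k = (w ! k, w ! (Suc k mod length w))"
proof (cases "Suc k < length u")
  case True
  then show ?thesis
    using assms length_u_le by (simp add: two_subwords_eq nth_append nth_tl nth_u less_diff_conv)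
next
  case False
  then have k: "length u = Suc k" using assms by simp
  \<comment> \<open>The letter that follows \<open>u\<close> cyclically in \<open>w\<close> is the
    first letter of \<open>w\<close> rotated by \<open>length u\<close>, that is, of
    \<open>w\<close> shifted by \<open>h\<close>. The \<open>mod\<close> covers the case that
    \<open>u\<close> is all of \<open>w\<close>.\<close>
  have "w ! (length u mod length w) = rotate (length u) w ! 0"
    using w_nonempty by (simp add: nth_rotate)
  also have "\<dots> = shift n h (hd u)"
    using w_nonempty u_nonempty nth_u[of 0] by (simp add: rotate_length_u hd_conv_nth)
  finally show ?thesis
    using k by (simp add: two_subwords_eq nth_append nth_u)
qed

lemma edges_star_graph:
  "edges (star_graph (cyclic_presentation n w)) =
    (\<Sum>i<n. {#Upair (shift n i x) (inv_letter (shift n i y)). (x, y) \<in># mset (two_subwords n u h)#})"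
proof -
  have "edges (star_graph (cyclic_presentation n w)) =
     (\<Sum>r\<in>rotations. {#star_edge_ends r#})"
    by (simp add: edges_star_graph_rotations image_mset_mset_set_sum)
  also have "\<dots> = (\<Sum>i<n. \<Sum>k<length u. {#star_edge_ends (rotate k (map (shift n i) w))#})"
    unfolding rotations_eq sum.reindex[OF inj_on_rotations] sum.cartesian_product
    by (simp add: case_prod_unfold)
  also have "\<dots> = (\<Sum>i<n. {#Upair (shift n i x) (inv_letter (shift n i y)). (x, y) \<in># mset (two_subwords n u h)#})"
  proof (rule sum.cong[OF refl])
    fix i assume "i \<in> {..<n}"
    have "star_edge_ends (rotate k (map (shift n i) w)) =
       (\<lambda>(x, y). Upair (shift n i x) (inv_letter (shift n i y))) (two_subwords n u h ! k)"
      if "k < length u" for k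
      using that w_nonempty length_u_le
      by (simp add: nth_two_subwords star_edge_ends_nth nth_rotate mod_simps)
    then have "(\<Sum>k<length u. {#star_edge_ends (rotate k (map (shift n i) w))#}) =
       image_mset (\<lambda>k. (\<lambda>(x, y). Upair (shift n i x) (inv_letter (shift n i y))) (two_subwords n u h ! k))
          (mset_set {..<length u})"
      by (simp add: image_mset_mset_set_sum)
    also have "\<dots> = image_mset (\<lambda>(x, y). Upair (shift n i x) (inv_letter (shift n i y)))
        (mset (map ((!) (two_subwords n u h)) [0..<length (two_subwords n u h)]))"
      by (simp add: length_two_subwords atLeast0LessThan image_mset.compositionality comp_def)
    also have "\<dots> = image_mset (\<lambda>(x, y). Upair (shift n i x) (inv_letter (shift n i y)))
        (mset (two_subwords n u h))"
      by (simp only: map_nth)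
    finally show "(\<Sum>k<length u. {#star_edge_ends (rotate k (map (shift n i) w))#}) =
      {#Upair (shift n i x) (inv_letter (shift n i y)). (x, y) \<in># mset (two_subwords n u h)#}" .
  qed
  finally show ?thesis .
qed

end

section \<open>Orbits of edges in terms of residues\<close>

lemma int_residue_diff: "0 < n \<Longrightarrow> int (residue_diff n j i) = (int j - int i) mod int n"
  by (simp add: residue_diff_def)

lemma add_residue_diff_mod:
  assumes "0 < n"
  shows "((i + k) mod n + residue_diff n j i) mod n = (j + k) mod n"
proof -
  have "int (((i + k) mod n + residue_diff n j i) mod n) = (int i + int k + (int j - int i)) mod int n"
    by (simp add: zmod_int int_residue_diff[OF assms] mod_add_left_eq mod_add_right_eq)
  also have "\<dots> = int ((j + k) mod n)"
    by (simp add: zmod_int add.commute)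
  finally show ?thesis by (simp only: of_nat_eq_iff)
qed

lemma inj_on_add_mod: "inj_on (\<lambda>k. (i + k) mod n) {..<n :: nat}"
proof (rule inj_onI)
  fix k l assume "k \<in> {..<n}" "l \<in> {..<n}" "(i + k) mod n = (i + l) mod n"
  then have "[i + k = i + l] (mod n)" by (simp add: cong_def)
  then have "[k = l] (mod n)" by (simp only: cong_add_lcancel_nat)
  then show "k = l"
    using \<open>k \<in> {..<n}\<close> \<open>l \<in> {..<n}\<close> by (simp add: cong_less_modulus_unique_nat)
qed

lemma bij_betw_add_mod: "0 < n \<Longrightarrow> bij_betw (\<lambda>k. (i + k) mod n) {..<n} {..<n :: nat}"
  by (intro bij_betw_imageI inj_on_add_mod endo_inj_surj) auto

text \<open>Reindexing by \<open>k \<mapsto> i + k\<close> modulo \<open>n\<close> makes the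
  subscript of the first end the summation index; only the difference of the subscripts
  remains.\<close>

lemma sum_Upair_shift:
  assumes "0 < n"
  shows "(\<Sum>k<n. {#Upair (C ((i + k) mod n)) (D ((j + k) mod n))#}) =
    (\<Sum>k<n. {#Upair (C k) (D ((k + residue_diff n j i) mod n))#})"
  using sum.reindex_bij_betw[OF bij_betw_add_mod[OF assms, of i],
      of "\<lambda>k. {#Upair (C k) (D ((k + residue_diff n j i) mod n))#}"]
  by (simp add: add_residue_diff_mod[OF assms])

text \<open>The single sum of the theorem is split into three by the signs of the end points, so
  that each kind of edge can be treated by itself.\<close>

definition pos_edges :: "nat \<Rightarrow> nat multiset \<Rightarrow> nat letter uprod multiset" where
  "pos_edges n A = (\<Sum>i<n. {#Upair (Pos i) (Pos ((i + a) mod n)). a \<in># A#})"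

definition neg_edges :: "nat \<Rightarrow> nat multiset \<Rightarrow> nat letter uprod multiset" where
  "neg_edges n B = (\<Sum>i<n. {#Upair (Neg i) (Neg ((i + b) mod n)). b \<in># B#})"

definition mixed_edges :: "nat \<Rightarrow> nat multiset \<Rightarrow> nat letter uprod multiset" where
  "mixed_edges n Q = (\<Sum>i<n. {#Upair (Pos i) (Neg ((i + q) mod n)). q \<in># Q#})"

lemma shift_edges_simps [simp]:
  "pos_edges n {#} = {#}"
  "pos_edges n (add_mset a A) = (\<Sum>i<n. {#Upair (Pos i) (Pos ((i + a) mod n))#}) + pos_edges n A"
  "neg_edges n {#} = {#}"
  "neg_edges n (add_mset a A) = (\<Sum>i<n. {#Upair (Neg i) (Neg ((i + a) mod n))#}) + neg_edges n A"
  "mixed_edges n {#} = {#}"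
  "mixed_edges n (add_mset a A) = (\<Sum>i<n. {#Upair (Pos i) (Neg ((i + a) mod n))#}) + mixed_edges n A"
  by (simp_all add: pos_edges_def neg_edges_def mixed_edges_def flip: sum.distrib)

lemma mixed_edges_union: "mixed_edges n (Q + R) = mixed_edges n Q + mixed_edges n R"
  by (simp add: mixed_edges_def sum.distrib)

text \<open>A subword \<open>x y\<close> gives an edge from \<open>x\<close> to the inverse of
  \<open>y\<close>. A change of sign thus joins vertices of equal sign, and equal signs join a
  positive vertex to a negative one.\<close>

lemma sum_pair_edges:
  assumes "0 < n"
  shows "(\<Sum>k<n. {#Upair (shift n k x) (inv_letter (shift n k y)). (x, y) \<in># mset ps#}) =
      pos_edges n (mset [residue_diff n j i. (Pos i, Neg j) \<leftarrow> ps])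
    + neg_edges n (mset [residue_diff n j i. (Neg i, Pos j) \<leftarrow> ps])
    + mixed_edges n (mset [residue_diff n j i. (Pos i, Pos j) \<leftarrow> ps] +
                     mset [residue_diff n j i. (Neg j, Neg i) \<leftarrow> ps])"
proof (induction ps)
  case (Cons xy ps)
  obtain x y where xy: "xy = (x, y)" by (cases xy)
  have "(\<Sum>k<n. {#Upair (shift n k x) (inv_letter (shift n k y)). (x, y) \<in># mset (xy # ps)#}) =
    (\<Sum>k<n. {#Upair (shift n k x) (inv_letter (shift n k y))#}) +
    (\<Sum>k<n. {#Upair (shift n k x) (inv_letter (shift n k y)). (x, y) \<in># mset ps#})"
    by (simp add: xy flip: sum.distrib)
  \<comment> \<open>Two negative letters list the negative end first. Exchanging the ends reverses
    the difference of subscripts, in accordance with the order of \<open>j\<close> and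
    \<open>i\<close> in \<open>multiset_Q\<close>.\<close>
  moreover have comm: "Upair (Neg a) (Pos b) = Upair (Pos b) (Neg a)" for a b :: nat
    by (simp add: Upair_inject)
  have "(\<Sum>k<n. {#Upair (Neg ((i + k) mod n)) (Pos ((j + k) mod n))#}) =
      (\<Sum>k<n. {#Upair (Pos k) (Neg ((k + residue_diff n i j) mod n))#})" for i j
    using sum_Upair_shift[OF assms, of Pos j Neg i] by (simp only: comm)
  ultimately show ?case
    unfolding Cons.IH
    by (cases x; cases y) (simp_all add: xy sum_Upair_shift[OF assms] mixed_edges_union)
qed simp

section \<open>Signs of letters and sizes of the three multisets\<close>

fun positive :: "'a letter \<Rightarrow> bool" where
  "positive (Pos a) \<longleftrightarrow> True"
| "positive (Neg a) \<longleftrightarrow> False"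

lemma positive_shift [simp]: "positive (shift n i x) \<longleftrightarrow> positive x"
  by (cases x) auto

text \<open>The two kinds of sign change alternate along a word, so their numbers differ by an
  amount that depends only on the signs of the end letters. Keeping those signs as correction terms
  makes the induction work.\<close>

lemma sign_changes_balanced:
  assumes "s \<noteq> []"
  shows "length [residue_diff n j i. (Pos i, Neg j) \<leftarrow> zip s (tl s)] + of_bool (\<not> positive (hd s)) =
    length [residue_diff n j i. (Neg i, Pos j) \<leftarrow> zip s (tl s)] + of_bool (\<not> positive (last s))"
  using assms
proof (induction s rule: induct_list012)
  case (3 x y s)
  then show ?case by (cases x; cases y) auto
qed auto

text \<open>The appended letter has the sign of the first letter of \<open>u\<close>, so the
  corrections in \<open>sign_changes_balanced\<close> agree. Each two-letter subword has one of four
  sign patterns and is counted once.\<close>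

lemma size_multisets:
  assumes "u \<noteq> []" "set u \<subseteq> letters {..<n}"
  shows "size (multiset_A n u h) = size (multiset_B n u h)"
    and "size (multiset_A n u h) + size (multiset_B n u h) + size (multiset_Q n u h) = length u"
proof -
  define s where "s = u @ [shift n h (hd u)]"
  have pairs: "two_subwords n u h = zip s (tl s)"
    using assms theta_funpow[of "[hd u]" n h] by (simp add: two_subwords_def Let_def subset_iff s_def)
  show "size (multiset_A n u h) = size (multiset_B n u h)"
    using sign_changes_balanced[of s n] assms(1)
    by (simp add: multiset_A_def multiset_B_def pairs) (simp add: s_def)
  have "length [residue_diff n j i. (Pos i, Neg j) \<leftarrow> ps] + length [residue_diff n j i. (Neg i, Pos j) \<leftarrow> ps]
    + (length [residue_diff n j i. (Pos i, Pos j) \<leftarrow> ps] + length [residue_diff n j i. (Neg j, Neg i) \<leftarrow> ps])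
    = length ps" for ps
  proof (induction ps)
    case (Cons xy ps)
    obtain x y where xy: "xy = (x, y)" by (cases xy)
    show ?case using Cons by (cases x; cases y) (auto simp: xy)
  qed simp
  from this[of "two_subwords n u h"]
  show "size (multiset_A n u h) + size (multiset_B n u h) + size (multiset_Q n u h) = length u"
    using assms(1) by (simp add: multiset_A_def multiset_B_def multiset_Q_def) (simp add: pairs s_def)
qed

lemma ball_zip_iff_list_all2_map:
  assumes "length xs = length ys"
  shows "(\<forall>(x, y)\<in>set (zip xs ys). P (f x) (f y)) \<longleftrightarrow> list_all2 P (map f xs) (map f ys)"
  using assms by (induction xs ys rule: list_induct2) auto

text \<open>Only signs matter, and the appended letter has the sign of \<open>hd u\<close>. The sign
  patterns in \<open>two_subwords\<close> are therefore those of the cyclic two-letter subwords of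
  \<open>u\<close>.\<close>

lemma multiset_Q_empty_iff:
  assumes "u \<noteq> []" "set u \<subseteq> letters {..<n}"
  shows "multiset_Q n u h = {#} \<longleftrightarrow> cyclically_alternating u"
proof -
  define z where "z = shift n h (hd u)"
  have pairs: "two_subwords n u h = zip u (tl u @ [z])"
  proof -
    have "two_subwords n u h = zip (u @ [z]) (tl u @ [z])"
      using assms theta_funpow[of "[hd u]" n h] by (simp add: two_subwords_def Let_def subset_iff z_def)
    then show ?thesis
      using assms(1) zip_append[of u "tl u @ [z]" "[z]" "[]"] by simp
  qed
  have "mset [residue_diff n j i. (Pos i, Pos j) \<leftarrow> ps] + mset [residue_diff n j i. (Neg j, Neg i) \<leftarrow> ps] = {#}
    \<longleftrightarrow> (\<forall>(x, y)\<in>set ps. positive x \<noteq> positive y)" for ps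
  proof (induction ps)
    case (Cons xy ps)
    obtain x y where xy: "xy = (x, y)" by (cases xy)
    show ?case using Cons by (cases x; cases y) (auto simp: xy)
  qed simp
  then have "multiset_Q n u h = {#} \<longleftrightarrow>
      (\<forall>(x, y)\<in>set (zip u (tl u @ [z])). positive x \<noteq> positive y)"
    by (simp only: multiset_Q_def pairs)
  also have "\<dots> \<longleftrightarrow> list_all2 (\<noteq>) (map positive u) (map positive (tl u @ [z]))"
    using assms(1) by (intro ball_zip_iff_list_all2_map) simp
  also have "map positive (tl u @ [z]) = map positive (rotate1 u)"
    using assms(1) by (cases u) (auto simp: z_def)
  also have "list_all2 (\<noteq>) (map positive u) (map positive (rotate1 u)) \<longleftrightarrow>
      (\<forall>(x, y)\<in>set (zip u (rotate1 u)). positive x \<noteq> positive y)"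
    by (intro ball_zip_iff_list_all2_map[symmetric]) simp
  also have "\<dots> \<longleftrightarrow> cyclically_alternating u"
  proof -
    have same: "positive x = positive y \<longleftrightarrow> (\<exists>i j. (x, y) = (Pos i, Pos j) \<or> (x, y) = (Neg j, Neg i))"
      for x y :: "nat letter"
      by (cases x; cases y) auto
    \<comment> \<open>A one-letter word is cyclically followed by itself, hence by a letter of the
      same sign.\<close>
    have "2 \<le> length u" if "\<forall>(x, y)\<in>set (zip u (rotate1 u)). positive x \<noteq> positive y"
    proof (rule ccontr)
      assume "\<not> 2 \<le> length u"
      then obtain x where "u = [x]" using assms(1) by (cases u; cases "tl u") auto
      then show False using that by simp
    qed
    then show ?thesis
      unfolding cyclically_alternating_def same[symmetric] by auto
  qed
  finally show ?thesis .
qed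

section \<open>Degrees\<close>

text \<open>The degree as a function of the edge multiset alone, where it is additive.\<close>

definition edge_degree :: "'v uprod multiset \<Rightarrow> 'v \<Rightarrow> nat" where
  "edge_degree M v = size {#e \<in># M. v \<in> set_uprod e#} + size {#e \<in># M. e = Upair v v#}"

lemma edge_degree_simps [simp]:
  "edge_degree {#} v = 0"
  "edge_degree (M + N) v = edge_degree M v + edge_degree N v"
  by (simp_all add: edge_degree_def)

lemma edge_degree_single: "edge_degree {#Upair x y#} v = of_bool (x = v) + of_bool (y = v)"
  by (auto simp: edge_degree_def)

lemma edge_degree_sum: "edge_degree (\<Sum>i\<in>I. f i) v = (\<Sum>i\<in>I. edge_degree (f i) v)"
  by (induction I rule: infinite_finite_induct) auto

text \<open>Since adding \<open>a\<close> permutes the residues, each end point of the orbit runs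
  through its vertices once. Loops arise when both ends coincide and are counted twice, as
  required.\<close>

lemma edge_degree_shift:
  assumes "0 < (n :: nat)"
  shows "edge_degree (\<Sum>i<n. {#Upair (C i) (D ((i + a) mod n))#}) v =
    (\<Sum>i<n. of_bool (C i = v)) + (\<Sum>i<n. of_bool (D i = v))"
  using sum.reindex_bij_betw[OF bij_betw_add_mod[OF assms, of a], of "\<lambda>i. of_bool (D i = v) :: nat"]
  by (simp add: edge_degree_sum edge_degree_single sum.distrib add.commute)

lemma sum_of_bool_eq:
  "(k :: nat) < n \<Longrightarrow> (\<Sum>i<n. of_bool (i = k)) = (1 :: nat)"
  by (simp add: of_bool_def)

lemma edge_degree_shift_edges:
  assumes "k < n"
  shows "edge_degree (pos_edges n A) (Pos k) = 2 * size A"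
    and "edge_degree (pos_edges n A) (Neg k) = 0"
    and "edge_degree (neg_edges n A) (Pos k) = 0"
    and "edge_degree (neg_edges n A) (Neg k) = 2 * size A"
    and "edge_degree (mixed_edges n A) (Pos k) = size A"
    and "edge_degree (mixed_edges n A) (Neg k) = size A"
proof -
  have "0 < n" using assms by simp
  note d = edge_degree_shift[OF this] sum_of_bool_eq[OF assms]
  show "edge_degree (pos_edges n A) (Pos k) = 2 * size A"
    by (induction A) (simp_all add: d)
  show "edge_degree (pos_edges n A) (Neg k) = 0"
    by (induction A) (simp_all add: d)
  show "edge_degree (neg_edges n A) (Pos k) = 0"
    by (induction A) (simp_all add: d)
  show "edge_degree (neg_edges n A) (Neg k) = 2 * size A"
    by (induction A) (simp_all add: d)
  show "edge_degree (mixed_edges n A) (Pos k) = size A"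
    by (induction A) (simp_all add: d)
  show "edge_degree (mixed_edges n A) (Neg k) = size A"
    by (induction A) (simp_all add: d)
qed

section \<open>Connected components\<close>

lemma reachable_refl [simp]: "reachable G x x"
  by (simp add: reachable_def)

lemma reachable_trans: "reachable G x y \<Longrightarrow> reachable G y z \<Longrightarrow> reachable G x z"
  by (simp add: reachable_def)

lemma reachable_edge: "Upair x y \<in># edges G \<Longrightarrow> reachable G x y"
  by (auto simp: reachable_def)

lemma reachable_sym:
  assumes "reachable G x y"
  shows "reachable G y x"
  using assms unfolding reachable_def
proof (induction rule: rtranclp_induct)
  case (step y z)
  have "Upair y z = Upair z y" by (simp add: Upair_inject)
  then show ?case using step by (metis (mono_tags, lifting) converse_rtranclp_into_rtranclp)
qed simp

text \<open>The colour is a complete invariant of reachability: edges preserve it and vertices of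
  equal colour are joined. Nonemptiness of the classes makes distinct colours give distinct
  components, which yields the count.\<close>

lemma connected_components_colouring:
  assumes colour: "\<And>x. x \<in> verts G \<Longrightarrow> c x \<in> I"
    and classes: "\<And>i. i \<in> I \<Longrightarrow> V i = {x \<in> verts G. c x = i}"
    and nonempty: "\<And>i. i \<in> I \<Longrightarrow> V i \<noteq> {}"
    and edge: "\<And>x y. Upair x y \<in># edges G \<Longrightarrow> c x = c y"
    and reach: "\<And>x y. x \<in> verts G \<Longrightarrow> y \<in> verts G \<Longrightarrow> c x = c y \<Longrightarrow> reachable G x y"
  shows "connected_components G = (\<lambda>i. induced_subgraph G (V i)) ` I"
    and "inj_on (\<lambda>i. induced_subgraph G (V i)) I"
proof -
  have inv: "c x = c y" if "reachable G x y" for x y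
    using that unfolding reachable_def by (induction rule: rtranclp_induct) (auto dest: edge)
  have comp: "{y \<in> verts G. reachable G x y} = V (c x)" if "x \<in> verts G" for x
    unfolding classes[OF colour[OF that]] by (intro Collect_cong) (metis that inv reach)
  show "connected_components G = (\<lambda>i. induced_subgraph G (V i)) ` I"
  proof (intro equalityI subsetI)
    fix C assume "C \<in> connected_components G"
    then show "C \<in> (\<lambda>i. induced_subgraph G (V i)) ` I"
      by (auto simp: connected_components_def comp intro!: imageI colour)
  next
    fix C assume "C \<in> (\<lambda>i. induced_subgraph G (V i)) ` I"
    then obtain i where i: "i \<in> I" "C = induced_subgraph G (V i)" by auto
    obtain x where "x \<in> V i" using nonempty[OF i(1)] by blast
    then have "x \<in> verts G" "c x = i"
      using classes[OF i(1)] by auto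
    then show "C \<in> connected_components G"
      unfolding connected_components_def i(2) by (auto intro!: exI[of _ x] simp: comp)
  qed
  show "inj_on (\<lambda>i. induced_subgraph G (V i)) I"
  proof (rule inj_onI)
    fix i j assume ij: "i \<in> I" "j \<in> I" "induced_subgraph G (V i) = induced_subgraph G (V j)"
    then have "V i = V j" by (simp add: induced_subgraph_def)
    obtain x where "x \<in> V i" using nonempty[OF ij(1)] by blast
    with \<open>V i = V j\<close> have "c x = i" "c x = j"
      using classes[OF ij(1)] classes[OF ij(2)] by auto
    then show "i = j" by simp
  qed
qed

section \<open>Subgroups of the integers and arithmetic progressions modulo \<open>n\<close>\<close>

lemma mult_mem_if_closed:
  fixes H :: "int set"
  assumes "0 \<in> H" "\<And>x y. x \<in> H \<Longrightarrow> y \<in> H \<Longrightarrow> x + y \<in> H" "\<And>x. x \<in> H \<Longrightarrow> - x \<in> H" "x \<in> H"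
  shows "k * x \<in> H"
proof -
  have nonneg: "int m * x \<in> H" for m
    by (induction m) (simp_all add: assms distrib_right)
  show ?thesis
  proof (cases k)
    case (neg m)
    then have "k * x = - (int (Suc m) * x)" by (simp only: minus_mult_left)
    then show ?thesis by (simp only: assms(3) nonneg)
  qed (simp add: nonneg)
qed

text \<open>The set \<open>H\<close> is a subgroup of the integers, so Bezout keeps the gcd in
  \<open>H\<close> as elements are added to \<open>X\<close> one by one.\<close>

lemma Gcd_mem_if_closed:
  fixes H :: "int set"
  assumes "0 \<in> H" "\<And>x y. x \<in> H \<Longrightarrow> y \<in> H \<Longrightarrow> x + y \<in> H" "\<And>x. x \<in> H \<Longrightarrow> - x \<in> H"
    and "finite X" "X \<subseteq> H"
  shows "Gcd X \<in> H"
  using assms(4,5)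
proof (induction X)
  case (insert x X)
  obtain a b where "a * x + b * Gcd X = gcd x (Gcd X)" using bezout_int by blast
  moreover have "a * x \<in> H" "b * Gcd X \<in> H"
    using insert mult_mem_if_closed[OF assms(1-3)] by auto
  ultimately show ?case using assms(2) by (metis Gcd_insert)
qed (simp add: assms)

text \<open>As \<open>d\<close> divides \<open>n\<close>, the progression goes round the residues
  modulo \<open>n\<close> once and fills a residue class modulo \<open>d\<close>. Integers are used
  because \<open>i - c\<close> may be negative.\<close>

lemma progression_mod:
  assumes "0 < n" "d dvd n" "j < d"
  shows "{(j + t * d + c) mod n |t. t < n div d} = {i. i < n \<and> (int i - int c) mod int d = int j}"
proof (intro equalityI subsetI)
  fix i assume "i \<in> {(j + t * d + c) mod n |t. t < n div d}"
  then obtain t where i: "i = (j + t * d + c) mod n" by auto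
  have "(int i - int c) mod int d = (int i mod int d - int c) mod int d" by (simp add: mod_simps)
  also have "int i mod int d = int (j + t * d + c) mod int d"
    using assms(2) by (simp add: i zmod_int mod_mod_cancel)
  also have "(int (j + t * d + c) mod int d - int c) mod int d = (int j + int t * int d) mod int d"
    by (simp add: mod_simps)
  also have "\<dots> = int j" using assms(3) by simp
  finally show "i \<in> {i. i < n \<and> (int i - int c) mod int d = int j}"
    using assms(1) by (simp add: i)
next
  fix i assume i: "i \<in> {i. i < n \<and> (int i - int c) mod int d = int j}"
  \<comment> \<open>The quotient \<open>s\<close> is the wanted index except that it may be
    negative. Reducing it modulo \<open>m = n div d\<close> changes \<open>d * s\<close> only by a
    multiple of \<open>n\<close>.\<close>
  define s where "s = (int i - int c) div int d"
  have s: "int i = int j + int d * s + int c"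
    using i mult_div_mod_eq[of "int d" "int i - int c"] by (simp add: s_def)
  define m where "m = n div d"
  have nm: "n = d * m" "0 < m" using assms by (auto simp: m_def)
  define t where "t = nat (s mod int m)"
  have t: "t < m" "int t = s mod int m" using nm by (auto simp: t_def nat_less_iff)
  have "int ((j + t * d + c) mod n) = (int j + int d * (s mod int m) + int c) mod int n"
    by (simp add: zmod_int t(2) mult.commute)
  also have "int d * (s mod int m) = (int d * s) mod int n"
    by (simp only: nm(1) of_nat_mult mult_mod_right)
  also have "(int j + (int d * s) mod int n + int c) mod int n = int i mod int n"
    unfolding s by (metis mod_add_left_eq mod_add_right_eq)
  also have "\<dots> = int i" using i by simp
  finally have "i = (j + t * d + c) mod n" by simp
  then show "i \<in> {(j + t * d + c) mod n |t. t < n div d}"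
    using t(1) by (auto simp: m_def)
qed

lemma inj_on_progression:
  assumes "0 < (n :: nat)" "d dvd n"
  shows "inj_on (\<lambda>t. (j + t * d + c) mod n) {..<n div d}"
proof (rule inj_onI)
  fix s t assume st: "s \<in> {..<n div d}" "t \<in> {..<n div d}"
    "(j + s * d + c) mod n = (j + t * d + c) mod n"
  have "0 < d" using assms dvd_pos_nat by blast
  obtain m where m: "n = d * m" using assms(2) by blast
  have "[j + s * d + c = j + t * d + c] (mod n)"
    using st(3) by (simp only: cong_def)
  then have "[s * d = t * d] (mod n)"
    by (simp only: cong_add_rcancel_nat cong_add_lcancel_nat)
  moreover have "s * d < n" "t * d < n"
    using st(1,2) \<open>0 < d\<close> by (simp_all add: m mult.commute)
  ultimately have "s * d = t * d"
    by (rule cong_less_modulus_unique_nat)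
  then show "s = t" using \<open>0 < d\<close> by simp
qed

lemma card_progression:
  assumes "0 < (n :: nat)" "d dvd n"
  shows "card {(j + t * d + c) mod n |t. t < n div d} = n div d"
proof -
  have "{(j + t * d + c) mod n |t. t < n div d} = (\<lambda>t. (j + t * d + c) mod n) ` {..<n div d}" by auto
  then show ?thesis by (simp add: card_image inj_on_progression assms)
qed

text \<open>The displacements \<open>y\<close> for which every \<open>f z\<close> is joined to
  \<open>f (z + y)\<close> form a subgroup \<open>H\<close> of the integers. The quantifier over all
  \<open>z\<close> gives closure under sums and negatives, so \<open>H\<close> contains
  \<open>Gcd X\<close> and its multiples.\<close>

lemma reachable_Gcd:
  fixes f :: "int \<Rightarrow> 'v"
  assumes "finite X" "\<And>x z. x \<in> X \<Longrightarrow> reachable G (f z) (f (z + x))" "Gcd X dvd z' - z"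
  shows "reachable G (f z) (f z')"
proof -
  define H where "H = {y. \<forall>z. reachable G (f z) (f (z + y))}"
  have zero: "0 \<in> H" by (simp add: H_def)
  have add: "x + y \<in> H" if "x \<in> H" "y \<in> H" for x y
    unfolding H_def
  proof (intro CollectI allI)
    fix z
    have "reachable G (f z) (f (z + x))" "reachable G (f (z + x)) (f (z + x + y))"
      using that unfolding H_def by blast+
    from reachable_trans[OF this] show "reachable G (f z) (f (z + (x + y)))"
      by (simp only: add.assoc)
  qed
  have neg: "- x \<in> H" if "x \<in> H" for x
    unfolding H_def
  proof (intro CollectI allI)
    fix z
    have "reachable G (f (z - x)) (f (z - x + x))" using that unfolding H_def by blast
    then show "reachable G (f z) (f (z + - x))" by (simp add: reachable_sym)
  qed
  have "X \<subseteq> H" using assms(2) by (auto simp: H_def)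
  then have "Gcd X \<in> H"
    using Gcd_mem_if_closed[of H X] zero add neg assms(1) by blast
  moreover obtain k where "z' - z = k * Gcd X" using assms(3) by (metis dvdE mult.commute)
  ultimately have "z' - z \<in> H"
    using mult_mem_if_closed[of H "Gcd X" k] zero add neg by simp
  then have "reachable G (f z) (f (z + (z' - z)))" unfolding H_def by blast
  then show ?thesis by simp
qed

lemma int_add_mod_diff_mod:
  assumes "d dvd n"
  shows "(int ((i + a) mod n) - c) mod int d = (int i + int a - c) mod int d"
proof -
  have "(int ((i + a) mod n) - c) mod int d = (int ((i + a) mod n) mod int d - c) mod int d"
    by (simp only: mod_diff_left_eq)
  also have "int ((i + a) mod n) mod int d = (int i + int a) mod int d"
    using assms by (simp add: zmod_int mod_mod_cancel)
  finally show ?thesis by (simp only: mod_diff_left_eq)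
qed

lemma nat_add_mod:
  assumes "0 < n"
  shows "nat ((z + int a) mod int n) = (nat (z mod int n) + a) mod n"
proof -
  have "int ((nat (z mod int n) + a) mod n) = (z + int a) mod int n"
    using assms by (simp add: zmod_int mod_add_left_eq)
  then show ?thesis by (metis nat_int)
qed

section \<open>Components of a graph given by its edge orbits\<close>

context
  fixes n :: nat and A B Q :: "nat multiset" and G :: "nat letter multigraph"
  assumes n_pos: "0 < n"
    and verts_G: "verts G = {Pos i |i. i < n} \<union> {Neg i |i. i < n}"
    and edges_G: "edges G = pos_edges n A + neg_edges n B + mixed_edges n Q"
begin

lemma edge_cases:
  assumes "Upair x y \<in># edges G"
  obtains i a where "i < n" "a \<in># A" "Upair x y = Upair (Pos i) (Pos ((i + a) mod n))"
  | i b where "i < n" "b \<in># B" "Upair x y = Upair (Neg i) (Neg ((i + b) mod n))"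
  | i q where "i < n" "q \<in># Q" "Upair x y = Upair (Pos i) (Neg ((i + q) mod n))"
  using assms unfolding edges_G pos_edges_def neg_edges_def mixed_edges_def
  by (auto simp: set_mset_sum)

text \<open>Vertices are indexed by all integers with period \<open>n\<close>, so that displacements
  can be added and inverted freely.\<close>

definition pos_vertex :: "int \<Rightarrow> nat letter" where "pos_vertex z = Pos (nat (z mod int n))"
definition neg_vertex :: "int \<Rightarrow> nat letter" where "neg_vertex z = Neg (nat (z mod int n))"

lemma vertex_int: "i < n \<Longrightarrow> pos_vertex (int i) = Pos i" "i < n \<Longrightarrow> neg_vertex (int i) = Neg i"
  by (simp_all add: pos_vertex_def neg_vertex_def)

lemma vertex_add_n: "pos_vertex (z + int n) = pos_vertex z" "neg_vertex (z + int n) = neg_vertex z"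
  by (simp_all add: pos_vertex_def neg_vertex_def)

lemma nat_mod_less: "nat (z mod int n) < n"
  using n_pos by (simp add: nat_less_iff)

lemma reachable_A: "a \<in># A \<Longrightarrow> reachable G (pos_vertex z) (pos_vertex (z + int a))"
  using nat_mod_less[of z] by (intro reachable_edge)
    (auto simp: edges_G pos_edges_def set_mset_sum pos_vertex_def nat_add_mod[OF n_pos])

lemma reachable_B: "b \<in># B \<Longrightarrow> reachable G (neg_vertex z) (neg_vertex (z + int b))"
  using nat_mod_less[of z] by (intro reachable_edge)
    (auto simp: edges_G neg_edges_def set_mset_sum neg_vertex_def nat_add_mod[OF n_pos])

lemma reachable_Q: "q \<in># Q \<Longrightarrow> reachable G (pos_vertex z) (neg_vertex (z + int q))"
  using nat_mod_less[of z] by (intro reachable_edge)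
    (auto simp: edges_G mixed_edges_def set_mset_sum pos_vertex_def neg_vertex_def
      nat_add_mod[OF n_pos])

text \<open>Edges with difference \<open>q0\<close> tie each negative vertex to a positive one, so
  it suffices to study displacements between positive vertices. Those listed in the gcd can all be
  realised by paths, and no edge changes the resulting residue modulo \<open>d\<close>.\<close>

lemma connected_components_mixed:
  fixes q0 d :: nat
  defines "V \<equiv> \<lambda>j. {Pos ((j + t * d) mod n) |t. t < n div d} \<union>
    {Neg ((j + t * d + q0) mod n) |t. t < n div d}"
  assumes q0: "q0 \<in># Q"
    and d: "d = nat (Gcd (insert (int n)
      (int ` set_mset A \<union> int ` set_mset B \<union> (\<lambda>q. int q - int q0) ` set_mset Q)))"
  shows "0 < d" "d dvd n"
    "\<And>j. j < d \<Longrightarrow> V j = {Pos i |i. i < n \<and> int i mod int d = int j} \<union>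
      {Neg i |i. i < n \<and> (int i - int q0) mod int d = int j}"
    "connected_components G = (\<lambda>j. induced_subgraph G (V j)) ` {..<d}"
    "card (connected_components G) = d"
proof -
  define X where "X = insert (int n)
      (int ` set_mset A \<union> int ` set_mset B \<union> (\<lambda>q. int q - int q0) ` set_mset Q)"
  have int_d: "int d = Gcd X" by (simp add: d X_def)
  have "finite X" by (simp add: X_def)
  have dvd_X: "int d dvd x" if "x \<in> X" for x
    using that unfolding int_d by (rule Gcd_dvd)
  show "d dvd n" using dvd_X[of "int n"] by (simp add: X_def)
  then show "0 < d" using n_pos dvd_pos_nat by blast
  have dvd_A: "int d dvd int a" if "a \<in># A" for a using that by (intro dvd_X) (auto simp: X_def)
  have dvd_B: "int d dvd int b" if "b \<in># B" for b using that by (intro dvd_X) (auto simp: X_def)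
  have dvd_Q: "int d dvd int q - int q0" if "q \<in># Q" for q
    using that by (intro dvd_X) (auto simp: X_def)
  have V: "V j = {Pos i |i. i < n \<and> int i mod int d = int j} \<union>
      {Neg i |i. i < n \<and> (int i - int q0) mod int d = int j}" if "j < d" for j
  proof -
    have "V j = Pos ` {(j + t * d + 0) mod n |t. t < n div d} \<union>
        Neg ` {(j + t * d + q0) mod n |t. t < n div d}"
      by (auto simp: V_def)
    also have "\<dots> = {Pos i |i. i < n \<and> int i mod int d = int j} \<union>
      {Neg i |i. i < n \<and> (int i - int q0) mod int d = int j}"
      unfolding progression_mod[OF n_pos \<open>d dvd n\<close> that] by auto
    finally show ?thesis .
  qed
  then show "\<And>j. j < d \<Longrightarrow> V j = {Pos i |i. i < n \<and> int i mod int d = int j} \<union>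
      {Neg i |i. i < n \<and> (int i - int q0) mod int d = int j}" .
  \<comment> \<open>\<open>rep\<close> is the index of a positive vertex in the same component; for
    a negative vertex it is found by going back along its edge with difference
    \<open>q0\<close>.\<close>
  define rep :: "nat letter \<Rightarrow> int" where
    "rep x = (case x of Pos i \<Rightarrow> int i | Neg i \<Rightarrow> int i - int q0)" for x
  define c where "c x = nat (rep x mod int d)" for x
  have c_eq: "c x = c y \<longleftrightarrow> int d dvd rep x - rep y" for x y
    using \<open>0 < d\<close> by (simp add: c_def mod_eq_dvd_iff[symmetric] eq_nat_nat_iff)
  have edge_rep: "int d dvd int ((i + a) mod n) - x \<longleftrightarrow> int d dvd int i + int a - x" for i a x
    using int_add_mod_diff_mod[OF \<open>d dvd n\<close>, of i a x] by (simp add: dvd_eq_mod_eq_0)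
  have to_pos: "reachable G x (pos_vertex (rep x))" if "x \<in> verts G" for x
  proof (cases x)
    case (Pos i)
    then show ?thesis using that by (simp add: verts_G rep_def vertex_int)
  next
    case (Neg i)
    then show ?thesis
      using that reachable_Q[OF q0, of "int i - int q0"]
      by (simp add: verts_G rep_def vertex_int reachable_sym)
  qed
  have step: "reachable G (pos_vertex z) (pos_vertex (z + x))" if x: "x \<in> X" for x z
  proof -
    consider "x = int n" | a where "x = int a" "a \<in># A" | b where "x = int b" "b \<in># B"
      | q where "x = int q - int q0" "q \<in># Q"
      using x unfolding X_def by blast
    then show ?thesis
    proof cases
      case 1
      then show ?thesis by (simp add: vertex_add_n)
    next
      case 2
      then show ?thesis by (simp add: reachable_A)
    next
      \<comment> \<open>Cross to the negative vertices by \<open>q0\<close>, move there by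
        \<open>b\<close>, and cross back by \<open>q0\<close>.\<close>
      case (3 b)
      have "reachable G (pos_vertex z) (neg_vertex (z + int q0 + int b))"
        by (rule reachable_trans[OF reachable_Q[OF q0] reachable_B[OF 3(2)]])
      moreover have "reachable G (neg_vertex (z + int q0 + int b)) (pos_vertex (z + x))"
        using reachable_Q[OF q0, of "z + x"] by (simp add: 3(1) reachable_sym ac_simps)
      ultimately show ?thesis by (rule reachable_trans)
    next
      \<comment> \<open>Cross over by \<open>q\<close> and return by \<open>q0\<close>.\<close>
      case (4 q)
      have "reachable G (neg_vertex (z + int q)) (pos_vertex (z + x))"
        using reachable_Q[OF q0, of "z + x"] by (simp add: 4(1) reachable_sym)
      then show ?thesis by (rule reachable_trans[OF reachable_Q[OF 4(2)]])
    qed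
  qed
  have colour: "c x \<in> {..<d}" for x
    using \<open>0 < d\<close> by (simp add: c_def nat_less_iff)
  have classes: "V j = {x \<in> verts G. c x = j}" if "j \<in> {..<d}" for j
  proof -
    have "c x = j \<longleftrightarrow> rep x mod int d = int j" for x
      using \<open>0 < d\<close> by (simp add: c_def nat_eq_iff)
    moreover have "x \<in> V j \<longleftrightarrow> x \<in> verts G \<and> rep x mod int d = int j" for x
      unfolding V[OF that[unfolded lessThan_iff]] verts_G by (cases x) (simp_all add: rep_def)
    ultimately show ?thesis by (simp add: set_eq_iff)
  qed
  have nonempty: "V j \<noteq> {}" if "j \<in> {..<d}" for j
    using that n_pos \<open>d dvd n\<close> \<open>0 < d\<close> by (auto simp: V_def div_greater_zero_iff dvd_imp_le intro!: exI[of _ 0])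
  have edge: "c x = c y" if "Upair x y \<in># edges G" for x y
  proof -
    from that show ?thesis
    proof (cases rule: edge_cases)
      case (1 i a)
      then have "c (Pos ((i + a) mod n)) = c (Pos i)"
        using dvd_A by (simp add: c_eq rep_def edge_rep)
      then show ?thesis using 1(3) by (auto simp: Upair_inject)
    next
      case (2 i b)
      then have "c (Neg ((i + b) mod n)) = c (Neg i)"
        using dvd_B edge_rep[of i b "int i"] by (simp add: c_eq rep_def)
      then show ?thesis using 2(3) by (auto simp: Upair_inject)
    next
      case (3 i q)
      then have "c (Neg ((i + q) mod n)) = c (Pos i)"
        using dvd_Q edge_rep[of i q "int q0 + int i"] by (simp add: c_eq rep_def algebra_simps)
      then show ?thesis using 3(3) by (auto simp: Upair_inject)
    qed
  qed
  have reach: "reachable G x y" if "x \<in> verts G" "y \<in> verts G" "c x = c y" for x y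
  proof -
    have "Gcd X dvd rep y - rep x"
      using that(3)[symmetric] unfolding c_eq int_d .
    then have "reachable G (pos_vertex (rep x)) (pos_vertex (rep y))"
      using reachable_Gcd[of X G pos_vertex, OF \<open>finite X\<close> step] by blast
    then show ?thesis
      by (rule reachable_trans[OF to_pos[OF that(1)] reachable_trans[OF _ reachable_sym[OF to_pos[OF that(2)]]]])
  qed
  have components: "connected_components G = (\<lambda>j. induced_subgraph G (V j)) ` {..<d}"
      "inj_on (\<lambda>j. induced_subgraph G (V j)) {..<d}"
    by (rule connected_components_colouring[of G c "{..<d}" V, OF colour classes nonempty edge reach];
        assumption)+
  show "connected_components G = (\<lambda>j. induced_subgraph G (V j)) ` {..<d}"
    by (rule components(1))
  show "card (connected_components G) = d"
    unfolding components(1) card_image[OF components(2)] by simp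
qed

text \<open>Without mixed edges the two signs never meet, and each has its own modulus. Colours in a
  disjoint sum allow one application of the colouring criterion to cover both families.\<close>

lemma connected_components_alternating:
  fixes dA dB :: nat
  defines "Vp \<equiv> \<lambda>j. {Pos ((j + t * dA) mod n) |t. t < n div dA}"
    and "Vm \<equiv> \<lambda>j. {Neg ((j + t * dB) mod n) |t. t < n div dB}"
  assumes Q: "Q = {#}"
    and dA: "dA = Gcd (insert n (set_mset A))" and dB: "dB = Gcd (insert n (set_mset B))"
  shows "connected_components G =
      (\<lambda>j. induced_subgraph G (Vp j)) ` {..<dA} \<union> (\<lambda>j. induced_subgraph G (Vm j)) ` {..<dB}"
    and "card (connected_components G) = dA + dB"
proof -
  have dvd: "dA dvd n" "dB dvd n" "\<And>a. a \<in># A \<Longrightarrow> dA dvd a" "\<And>b. b \<in># B \<Longrightarrow> dB dvd b"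
    by (simp_all add: dA dB) (metis Gcd_dvd dvd_trans gcd_dvd2)+
  have pos: "0 < dA" "0 < dB" using n_pos dvd(1,2) dvd_pos_nat by blast+
  have Vp: "Vp j = {Pos i |i. i < n \<and> i mod dA = j}" if "j < dA" for j
  proof -
    have "Vp j = Pos ` {(j + t * dA + 0) mod n |t. t < n div dA}"
      by (auto simp: Vp_def)
    also have "\<dots> = {Pos i |i. i < n \<and> i mod dA = j}"
      unfolding progression_mod[OF n_pos dvd(1) that] by (auto simp flip: zmod_int)
    finally show ?thesis .
  qed
  have Vm: "Vm j = {Neg i |i. i < n \<and> i mod dB = j}" if "j < dB" for j
  proof -
    have "Vm j = Neg ` {(j + t * dB + 0) mod n |t. t < n div dB}"
      by (auto simp: Vm_def)
    also have "\<dots> = {Neg i |i. i < n \<and> i mod dB = j}"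
      unfolding progression_mod[OF n_pos dvd(2) that] by (auto simp flip: zmod_int)
    finally show ?thesis .
  qed
  define c :: "nat letter \<Rightarrow> nat + nat" where
    "c x = (case x of Pos i \<Rightarrow> Inl (i mod dA) | Neg i \<Rightarrow> Inr (i mod dB))" for x
  define V where "V = case_sum Vp Vm"
  define I where "I = {..<dA} <+> {..<dB}"
  have colour: "c x \<in> I" for x
    using pos by (cases x) (auto simp: c_def I_def)
  have classes: "V j = {x \<in> verts G. c x = j}" if "j \<in> I" for j
    using that by (auto simp: I_def V_def Vp Vm verts_G c_def)
  have nonempty: "V j \<noteq> {}" if "j \<in> I" for j
    using that n_pos dvd pos
    by (auto simp: I_def V_def Vp_def Vm_def div_greater_zero_iff dvd_imp_le intro!: exI[of _ 0])
  have edge: "c x = c y" if "Upair x y \<in># edges G" for x y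
    using that
  proof (cases rule: edge_cases)
    case (1 i a)
    then have "c (Pos ((i + a) mod n)) = c (Pos i)"
      using dvd(1) dvd(3)[of a] by (auto simp: c_def mod_mod_cancel elim!: dvdE)
    then show ?thesis using 1(3) by (auto simp: Upair_inject)
  next
    case (2 i b)
    then have "c (Neg ((i + b) mod n)) = c (Neg i)"
      using dvd(2) dvd(4)[of b] by (auto simp: c_def mod_mod_cancel elim!: dvdE)
    then show ?thesis using 2(3) by (auto simp: Upair_inject)
  next
    case 3
    then show ?thesis by (simp add: Q)
  qed
  \<comment> \<open>The displacement \<open>n\<close> may be included since the indexed vertices
    have period \<open>n\<close>; it makes the gcd that of the theorem.\<close>
  define XA XB where "XA = int ` insert n (set_mset A)" and "XB = int ` insert n (set_mset B)"
  have Gcd_X: "Gcd XA = int dA" "Gcd XB = int dB" and finite_X: "finite XA" "finite XB"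
    unfolding XA_def XB_def dA dB Gcd_int_eq by simp_all
  have step_A: "reachable G (pos_vertex z) (pos_vertex (z + x))" if "x \<in> XA" for x z
    using that unfolding XA_def by (auto simp: vertex_add_n reachable_A)
  have step_B: "reachable G (neg_vertex z) (neg_vertex (z + x))" if "x \<in> XB" for x z
    using that unfolding XB_def by (auto simp: vertex_add_n reachable_B)
  have reach: "reachable G x y" if xy: "x \<in> verts G" "y \<in> verts G" "c x = c y" for x y
  proof -
    consider i k where "x = Pos i" "y = Pos k" "i < n" "k < n" "i mod dA = k mod dA"
      | i k where "x = Neg i" "y = Neg k" "i < n" "k < n" "i mod dB = k mod dB"
      using xy by (cases x; cases y) (auto simp: verts_G c_def)
    then show ?thesis
    proof cases
      case (1 i k)
      have "int dA dvd int k - int i"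
        using 1(5) by (metis mod_eq_dvd_iff zmod_int)
      then have "reachable G (pos_vertex (int i)) (pos_vertex (int k))"
        by (intro reachable_Gcd[of XA G pos_vertex, OF finite_X(1) step_A]) (simp_all add: Gcd_X)
      then show ?thesis using 1 by (simp add: vertex_int)
    next
      case (2 i k)
      have "int dB dvd int k - int i"
        using 2(5) by (metis mod_eq_dvd_iff zmod_int)
      then have "reachable G (neg_vertex (int i)) (neg_vertex (int k))"
        by (intro reachable_Gcd[of XB G neg_vertex, OF finite_X(2) step_B]) (simp_all add: Gcd_X)
      then show ?thesis using 2 by (simp add: vertex_int)
    qed
  qed
  have components: "connected_components G = (\<lambda>j. induced_subgraph G (V j)) ` I"
      "inj_on (\<lambda>j. induced_subgraph G (V j)) I"
    by (rule connected_components_colouring[of G c I V, OF colour classes nonempty edge reach];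
        assumption)+
  show "connected_components G =
      (\<lambda>j. induced_subgraph G (Vp j)) ` {..<dA} \<union> (\<lambda>j. induced_subgraph G (Vm j)) ` {..<dB}"
    unfolding components(1) by (auto simp: I_def V_def image_Un image_image Plus_def)
  show "card (connected_components G) = dA + dB"
    unfolding components(1) card_image[OF components(2)] by (simp add: I_def card_Plus)
qed

end

section \<open>Circulant components\<close>

lemma image_mset_sum: "image_mset f (\<Sum>x\<in>I. g x) = (\<Sum>x\<in>I. image_mset f (g x))"
  by (induction I rule: infinite_finite_induct) auto

lemma filter_mset_sum: "filter_mset P (\<Sum>x\<in>I. g x) = (\<Sum>x\<in>I. filter_mset P (g x))"
  by (induction I rule: infinite_finite_induct) auto

text \<open>The residue class of \<open>j\<close> is parametrised by
  \<open>t \<mapsto> j + t * d\<close>, which turns a displacement \<open>a\<close> modulo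
  \<open>n\<close> into \<open>a div d\<close> modulo \<open>n div d\<close>. \<open>K\<close>
  stands for \<open>Pos\<close> or \<open>Neg\<close>, and \<open>N\<close> collects the edges of
  the other sign, none of which lies within the class.\<close>

lemma graph_isomorphic_circulant:
  fixes K :: "nat \<Rightarrow> 'v"
  assumes "0 < n" "d dvd n" "j < d" "inj K" "\<And>a. a \<in># M \<Longrightarrow> d dvd a"
    and edges: "edges G = (\<Sum>i<n. {#Upair (K i) (K ((i + a) mod n)). a \<in># M#}) + N"
    and N: "\<And>e. e \<in># N \<Longrightarrow> \<not> set_uprod e \<subseteq> range K"
  shows "graph_isomorphic (induced_subgraph G {K ((j + t * d) mod n) |t. t < n div d})
    (circulant_graph (n div d) {#a div d. a \<in># M#})"
proof -
  define m where "m = n div d"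
  have "0 < d" using assms(3) by simp
  have nm: "n = d * m" "0 < m" using assms(1,2) by (auto simp: m_def)
  define r where "r t = (j + t * d) mod n" for t
  define g where "g t = K (r t)" for t
  have inj_r: "inj_on r {..<m}"
    using inj_on_progression[OF assms(1,2), of j 0] by (simp add: r_def[abs_def] m_def)
  have inj_g: "inj_on g {..<m}"
    using inj_r assms(4) by (auto simp: inj_on_def g_def dest: injD)
  have V: "{K ((j + t * d) mod n) |t. t < n div d} = g ` {..<m}"
    by (auto simp: g_def r_def m_def)
  have image_r: "r ` {..<m} = {i. i < n \<and> i mod d = j}"
    using progression_mod[OF assms(1,2,3), of 0]
    by (auto simp: r_def m_def set_eq_iff image_iff simp flip: zmod_int)
  have image_g: "g ` {..<m} = K ` {i. i < n \<and> i mod d = j}"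
    by (simp only: image_r[symmetric] image_image g_def[abs_def])
  have g_mod: "K ((r t + a) mod n) = g ((t + a div d) mod m)" if a: "a \<in># M" for t a
  proof -
    obtain b where b: "a = d * b" using assms(5)[OF a] by blast
    have "(r t + a) mod n = (j + (t + b) * d) mod n"
      by (simp add: r_def b mod_simps algebra_simps)
    also have "\<dots> = (j + (d * (t + b)) mod n) mod n"
      by (simp only: mod_add_right_eq mult.commute)
    also have "(d * (t + b)) mod n = ((t + b) mod m) * d"
      by (simp only: nm(1) mult_mod_right mult.commute)
    finally show ?thesis using \<open>0 < d\<close> by (simp add: g_def r_def b)
  qed
  define S where "S = g ` {..<m}"
  have in_S: "K i \<in> S \<longleftrightarrow> i < n \<and> i mod d = j" for i
    using assms(4) by (auto simp: S_def image_g dest: injD)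
  \<comment> \<open>As \<open>d\<close> divides \<open>n\<close> and every \<open>a\<close>, the two
    ends of an edge lie in the same residue class modulo \<open>d\<close>, so the first end decides
    whether the edge is kept.\<close>
  have filter_edges: "filter_mset (\<lambda>e. set_uprod e \<subseteq> S) {#Upair (K i) (K ((i + a) mod n)). a \<in># M#} =
      (if i mod d = j then {#Upair (K i) (K ((i + a) mod n)). a \<in># M#} else {#})" if "i < n" for i
  proof -
    have *: "K ((i + a) mod n) \<in> S" if "a \<in># M" "i mod d = j" for a
      using assms(1,2) assms(5)[OF that(1)] that(2) by (auto simp: in_S mod_mod_cancel elim!: dvdE)
    have "filter_mset (\<lambda>e. set_uprod e \<subseteq> S) {#Upair (K i) (K ((i + a) mod n)). a \<in># M#} =
        filter_mset (\<lambda>_. i mod d = j) {#Upair (K i) (K ((i + a) mod n)). a \<in># M#}"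
      using * that in_S[of i] by (intro filter_mset_cong refl) auto
    then show ?thesis by simp
  qed
  have "S \<subseteq> range K" by (auto simp: S_def g_def)
  then have "filter_mset (\<lambda>e. set_uprod e \<subseteq> S) N = filter_mset (\<lambda>_. False) N"
    using N by (intro filter_mset_cong refl) blast
  then have "filter_mset (\<lambda>e. set_uprod e \<subseteq> S) (edges G) =
      (\<Sum>i<n. if i mod d = j then {#Upair (K i) (K ((i + a) mod n)). a \<in># M#} else {#})"
    by (simp add: edges filter_mset_sum filter_edges)
  also have "\<dots> = (\<Sum>i\<in>r ` {..<m}. {#Upair (K i) (K ((i + a) mod n)). a \<in># M#})"
    unfolding image_r by (simp add: sum.If_cases Int_def)
  also have "\<dots> = (\<Sum>t<m. {#Upair (g t) (g ((t + a div d) mod m)). a \<in># M#})"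
    unfolding sum.reindex[OF inj_r]
    unfolding o_apply by (intro sum.cong image_mset_cong refl arg_cong2[of _ _ _ _ Upair])
      (simp_all add: g_mod g_def)
  finally have edges_induced: "edges (induced_subgraph G S) =
      (\<Sum>t<m. {#Upair (g t) (g ((t + a div d) mod m)). a \<in># M#})"
    by (simp add: induced_subgraph_def)
  \<comment> \<open>The isomorphism sends the vertex with parameter \<open>t\<close> back to
    \<open>t\<close>.\<close>
  define f where "f = the_inv_into {..<m} g"
  have f: "f (g t) = t" if "t < m" for t
    using that inj_g by (simp add: f_def the_inv_into_f_f)
  have "bij_betw f S {..<m}"
    unfolding S_def f_def by (rule bij_betw_the_inv_into) (simp add: inj_g bij_betw_def)
  moreover have "image_mset (map_uprod f) (edges (induced_subgraph G S)) =
      edges (circulant_graph m {#a div d. a \<in># M#})"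
    unfolding edges_induced image_mset_sum circulant_graph_def
    by (simp add: image_mset.compositionality comp_def f nm(2))
  ultimately show ?thesis
    unfolding graph_isomorphic_def V unfolding S_def[symmetric] m_def[symmetric]
    by (intro exI[of _ f]) (simp add: induced_subgraph_def circulant_graph_def)
qed

section \<open>Regularity, edges and components of the star graph\<close>

theorem theorem5p2:
  fixes n h :: nat and w u :: "nat word"
    and \<Gamma> :: "nat letter multigraph" and A B Q :: "nat multiset" and dA dB :: nat
  assumes "w \<in> free_group {..<n}"
    and "w \<noteq> []"
    and "cyclically_reduced w"
    and "\<not> proper_power {..<n} w"
    and "orientable n w"
    and "shortest_shift_root n w u h"
    and "\<Gamma> = star_graph (cyclic_presentation n w)"
    and "A = multiset_A n u h"
    and "B = multiset_B n u h"
    and "Q = multiset_Q n u h"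
    and "dA = Gcd (insert n (set_mset A))"
    and "dB = Gcd (insert n (set_mset B))"
  shows "regular (length u) \<Gamma>
    \<and> verts \<Gamma> = {Pos i |i. i < n} \<union> {Neg i |i. i < n}
    \<and> edges \<Gamma> =
        (\<Sum>i<n. {#Upair (Pos i) (Pos ((i + a) mod n)). a \<in># A#}
             + {#Upair (Neg i) (Neg ((i + b) mod n)). b \<in># B#}
             + {#Upair (Pos i) (Neg ((i + q) mod n)). q \<in># Q#})
    \<and> (\<not> cyclically_alternating u \<longrightarrow>
        Q \<noteq> {#} \<and>
        (\<forall>q0 \<in># Q. \<forall>d Vp Vm \<Gamma>c.
            d = nat (Gcd (insert (int n)
                  (int ` set_mset A \<union> int ` set_mset B \<union> (\<lambda>q. int q - int q0) ` set_mset Q)))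
          \<longrightarrow> Vp = (\<lambda>j. {Pos ((j + t * d) mod n) |t. t < n div d})
          \<longrightarrow> Vm = (\<lambda>j. {Neg ((j + t * d + q0) mod n) |t. t < n div d})
          \<longrightarrow> \<Gamma>c = (\<lambda>j. induced_subgraph \<Gamma> (Vp j \<union> Vm j))
          \<longrightarrow> card (connected_components \<Gamma>) = d
            \<and> connected_components \<Gamma> = \<Gamma>c ` {..<d}
            \<and> (\<forall>j<d. card (verts (induced_subgraph \<Gamma> (Vp j))) = n div d
                   \<and> card (verts (induced_subgraph \<Gamma> (Vm j))) = n div d)
            \<and> (\<forall>C \<in> connected_components \<Gamma>. \<forall>i k.
                  (Pos i \<in> verts C \<and> Pos k \<in> verts C \<longrightarrow> i mod d = k mod d)
                \<and> (Neg i \<in> verts C \<and> Neg k \<in> verts C \<longrightarrow> i mod d = k mod d))))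
    \<and> (cyclically_alternating u \<longrightarrow>
        (\<forall>\<Gamma>p \<Gamma>m.
            \<Gamma>p = (\<lambda>j. induced_subgraph \<Gamma> {Pos ((j + t * dA) mod n) |t. t < n div dA})
          \<longrightarrow> \<Gamma>m = (\<lambda>j. induced_subgraph \<Gamma> {Neg ((j + t * dB) mod n) |t. t < n div dB})
          \<longrightarrow> card (connected_components \<Gamma>) = dA + dB
            \<and> connected_components \<Gamma> = \<Gamma>p ` {..<dA} \<union> \<Gamma>m ` {..<dB}
            \<and> (\<forall>j<dA. graph_isomorphic (\<Gamma>p j)
                   (circulant_graph (n div dA) {#a div dA. a \<in># A#}))
            \<and> (\<forall>j<dB. graph_isomorphic (\<Gamma>m j)
                   (circulant_graph (n div dB) {#b div dB. b \<in># B#}))))"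
proof -
  have "shift_presentation n h w u"
    using assms(1-6) by unfold_locales
  then interpret shift_presentation n h w u .
  have verts: "verts \<Gamma> = {Pos i |i. i < n} \<union> {Neg i |i. i < n}"
    unfolding assms(7) by (auto simp: star_graph_def cyclic_presentation_def letters_def)
  have edges: "edges \<Gamma> = pos_edges n A + neg_edges n B + mixed_edges n Q"
    unfolding assms(7) edges_star_graph sum_pair_edges[OF n_pos]
    by (simp only: assms(8-10) multiset_A_def multiset_B_def multiset_Q_def)
  have sizes: "size A = size B" "size A + size B + size Q = length u"
    using size_multisets[OF u_nonempty set_u, of h] by (simp_all only: assms(8-10))
  have Q_empty: "Q = {#} \<longleftrightarrow> cyclically_alternating u"
    unfolding assms(10) by (rule multiset_Q_empty_iff[OF u_nonempty set_u])
  have degree_eq: "degree \<Gamma> v = edge_degree (edges \<Gamma>) v" for v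
    by (simp add: degree_def edge_degree_def)
  \<comment> \<open>A positive vertex has degree \<open>2 * size A + size Q\<close> and a negative
    one \<open>2 * size B + size Q\<close>; both equal \<open>length u\<close> because
    \<open>size A = size B\<close>.\<close>
  have regular: "regular (length u) \<Gamma>"
    unfolding regular_def degree_eq
    using sizes by (auto simp: verts edges edge_degree_shift_edges)
  have edges_sum: "edges \<Gamma> =
        (\<Sum>i<n. {#Upair (Pos i) (Pos ((i + a) mod n)). a \<in># A#}
             + {#Upair (Neg i) (Neg ((i + b) mod n)). b \<in># B#}
             + {#Upair (Pos i) (Neg ((i + q) mod n)). q \<in># Q#})"
    unfolding edges pos_edges_def neg_edges_def mixed_edges_def sum.distrib ..
  have not_alternating: "card (connected_components \<Gamma>) = d
            \<and> connected_components \<Gamma> = \<Gamma>c ` {..<d}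
            \<and> (\<forall>j<d. card (verts (induced_subgraph \<Gamma> (Vp j))) = n div d
                   \<and> card (verts (induced_subgraph \<Gamma> (Vm j))) = n div d)
            \<and> (\<forall>C \<in> connected_components \<Gamma>. \<forall>i k.
                  (Pos i \<in> verts C \<and> Pos k \<in> verts C \<longrightarrow> i mod d = k mod d)
                \<and> (Neg i \<in> verts C \<and> Neg k \<in> verts C \<longrightarrow> i mod d = k mod d))"
    if q0: "q0 \<in># Q"
      and d: "d = nat (Gcd (insert (int n)
                  (int ` set_mset A \<union> int ` set_mset B \<union> (\<lambda>q. int q - int q0) ` set_mset Q)))"
      and Vp: "Vp = (\<lambda>j. {Pos ((j + t * d) mod n) |t. t < n div d})"
      and Vm: "Vm = (\<lambda>j. {Neg ((j + t * d + q0) mod n) |t. t < n div d})"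
      and \<Gamma>c: "\<Gamma>c = (\<lambda>j. induced_subgraph \<Gamma> (Vp j \<union> Vm j))"
    for q0 d Vp Vm \<Gamma>c
  proof (intro conjI ballI allI impI)
    note mixed = connected_components_mixed[OF n_pos verts edges q0 d]
    show "card (connected_components \<Gamma>) = d" by (rule mixed(5))
    show comps: "connected_components \<Gamma> = \<Gamma>c ` {..<d}"
      unfolding \<Gamma>c Vp Vm by (rule mixed(4))
    show "card (verts (induced_subgraph \<Gamma> (Vp j))) = n div d" for j
    proof -
      \<comment> \<open>The summand 0 is the offset \<open>c\<close> of
        \<open>card_progression\<close>; the negative vertices have offset
        \<open>q0\<close>.\<close>
      have "Vp j = Pos ` {(j + t * d + 0) mod n |t. t < n div d}" by (auto simp: Vp)
      then have "card (Vp j) = card {(j + t * d + 0) mod n |t. t < n div d}"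
        by (simp only: card_image inj_on_def letter.inject simp_thms ball_simps)
      then show ?thesis
        unfolding card_progression[OF n_pos mixed(2)] by (simp add: induced_subgraph_def)
    qed
    show "card (verts (induced_subgraph \<Gamma> (Vm j))) = n div d" for j
    proof -
      have "Vm j = Neg ` {(j + t * d + q0) mod n |t. t < n div d}" by (auto simp: Vm)
      then have "card (Vm j) = card {(j + t * d + q0) mod n |t. t < n div d}"
        by (simp only: card_image inj_on_def letter.inject simp_thms ball_simps)
      then show ?thesis
        unfolding card_progression[OF n_pos mixed(2)] by (simp add: induced_subgraph_def)
    qed
    fix C i k
    assume "C \<in> connected_components \<Gamma>"
    then obtain j where "j < d" "C = \<Gamma>c j" by (auto simp: comps)
    then have verts_C: "verts C = {Pos i |i. i < n \<and> int i mod int d = int j} \<union>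
        {Neg i |i. i < n \<and> (int i - int q0) mod int d = int j}"
      using mixed(3)[of j] by (simp add: \<Gamma>c induced_subgraph_def Vp Vm)
    show "i mod d = k mod d" if "Pos i \<in> verts C \<and> Pos k \<in> verts C"
    proof -
      have "int i mod int d = int k mod int d" using that by (auto simp: verts_C)
      then show ?thesis by (simp only: of_nat_eq_iff flip: zmod_int)
    qed
    show "i mod d = k mod d" if "Neg i \<in> verts C \<and> Neg k \<in> verts C"
    proof -
      have "(int i - int q0) mod int d = (int k - int q0) mod int d"
        using that by (auto simp: verts_C)
      then have "int i mod int d = int k mod int d" by (simp add: mod_eq_dvd_iff)
      then show ?thesis by (simp only: of_nat_eq_iff flip: zmod_int)
    qed
  qed
  have alternating: "card (connected_components \<Gamma>) = dA + dB
            \<and> connected_components \<Gamma> = \<Gamma>p ` {..<dA} \<union> \<Gamma>m ` {..<dB}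
            \<and> (\<forall>j<dA. graph_isomorphic (\<Gamma>p j)
                   (circulant_graph (n div dA) {#a div dA. a \<in># A#}))
            \<and> (\<forall>j<dB. graph_isomorphic (\<Gamma>m j)
                   (circulant_graph (n div dB) {#b div dB. b \<in># B#}))"
    if "cyclically_alternating u"
      and \<Gamma>p: "\<Gamma>p = (\<lambda>j. induced_subgraph \<Gamma> {Pos ((j + t * dA) mod n) |t. t < n div dA})"
      and \<Gamma>m: "\<Gamma>m = (\<lambda>j. induced_subgraph \<Gamma> {Neg ((j + t * dB) mod n) |t. t < n div dB})"
    for \<Gamma>p \<Gamma>m
  proof (intro conjI allI impI)
    have Q: "Q = {#}" using that(1) Q_empty by simp
    note alternating = connected_components_alternating[OF n_pos verts edges Q assms(11,12)]
    show "card (connected_components \<Gamma>) = dA + dB" by (rule alternating(2))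
    show "connected_components \<Gamma> = \<Gamma>p ` {..<dA} \<union> \<Gamma>m ` {..<dB}"
      unfolding \<Gamma>p \<Gamma>m by (rule alternating(1))
    have dvd: "dA dvd n" "dB dvd n" "\<And>a. a \<in># A \<Longrightarrow> dA dvd a" "\<And>b. b \<in># B \<Longrightarrow> dB dvd b"
      unfolding assms(11,12) by (rule Gcd_dvd; simp)+
    have inj: "inj Pos" "inj Neg" by (auto intro: injI)
    show "graph_isomorphic (\<Gamma>p j) (circulant_graph (n div dA) {#a div dA. a \<in># A#})" if "j < dA" for j
      unfolding \<Gamma>p
    proof (rule graph_isomorphic_circulant[OF n_pos dvd(1) that inj(1) dvd(3)])
      show "edges \<Gamma> = (\<Sum>i<n. {#Upair (Pos i) (Pos ((i + a) mod n)). a \<in># A#}) + neg_edges n B"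
        by (simp add: edges Q pos_edges_def)
      show "\<not> set_uprod e \<subseteq> range Pos" if "e \<in># neg_edges n B" for e
        using that by (auto simp: neg_edges_def set_mset_sum)
    qed
    show "graph_isomorphic (\<Gamma>m j) (circulant_graph (n div dB) {#b div dB. b \<in># B#})" if "j < dB" for j
      unfolding \<Gamma>m
    proof (rule graph_isomorphic_circulant[OF n_pos dvd(2) that inj(2) dvd(4)])
      show "edges \<Gamma> = (\<Sum>i<n. {#Upair (Neg i) (Neg ((i + a) mod n)). a \<in># B#}) + pos_edges n A"
        by (simp add: edges Q neg_edges_def add.commute)
      show "\<not> set_uprod e \<subseteq> range Neg" if "e \<in># pos_edges n A" for e
        using that by (auto simp: pos_edges_def set_mset_sum)
    qed
  qed
  show ?thesis
  proof (intro conjI[OF regular] conjI[OF verts] conjI[OF edges_sum] conjI impI)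
    assume "\<not> cyclically_alternating u"
    then show "Q \<noteq> {#}" using Q_empty by simp
  qed ((intro ballI allI impI, rule not_alternating; assumption),
      (intro allI impI, rule alternating; assumption))
qed

end
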